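(* Let $\rho>0$. Then there exist a transcendental meromorphic function $f\colon\mathbb{C}\to\hat{\mathbb{C}}$ and an invariant Baker domain $U$ of $f$ such that every point of $\operatorname{sing}(f^{-1})$ is a super-attracting periodic point of $f$ of period $2$, and such that there is a sequence $(R_j)$ of positive real numbers with $R_j\to\infty$ and $$\{z\in\mathbb{C}\colon R_j<|z|<\rho R_j\}\subset U\qquad\text{for all } j.$$
   Context: $\hat{\mathbb{C}}=\mathbb{C}\cup\{\infty\}$ is the Riemann sphere. A transcendental meromorphic function is a holomorphic map $f\colon\mathbb{C}\to\hat{\mathbb{C}}$ with an essential singularity at $\infty$ (i.e. not the restriction of a rational map). The Fatou set $F(f)$ is the set of $z\in\mathbb{C}$ having a neighbourhood on which all iterates $f^n$ are defined and form a normal family in the sense of Montel. A Fatou component is a connected component $U$ of $F(f)$; it is invariant if $f(U)\subset U$. An invariant Baker domain is an invariant Fatou component $U$ such that $f^n(z)\to\infty$ as $n\to\infty$ for all $z\in U$. $\operatorname{sing}(f^{-1})\subset\mathbb{C}$ is the set of finite critical values and finite asymptotic values of $f$. A critical value is the image $f(c)$ of a critical point $c\in\mathbb{C}$ (a point near which $f$ is not locally injective). A value $a$ is an asymptotic value if there is a curve $\gamma\colon[0,\infty)\to\mathbb{C}$ with $\gamma(t)\to\infty$ and $f(\gamma(t))\to a$ as $t\to\infty$. A point $z\in\mathbb{C}$ is a super-attracting periodic point of period $2$ if $f(z)\in\mathbb{C}$, $f(z)\neq z$, $f^2(z)=z$ and $(f^2)'(z)=0$. *)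

theory Defs
  imports "HOL-Complex_Analysis.Complex_Analysis"
begin

text \<open>
  A meromorphic function from the complex plane to the Riemann sphere is represented by a
  function \<open>f :: complex \<Rightarrow> complex\<close> with \<open>f nicely_meromorphic_on UNIV\<close>: its value at \<open>z\<close> is the
  point at infinity iff \<open>is_pole f z\<close> (where the library convention puts \<open>f z = 0\<close>), and it is
  \<open>f z\<close> otherwise. Every definition below that uses a value \<open>f z\<close> as a finite value therefore
  asserts \<open>\<not> is_pole f z\<close>.
\<close>

definition rational_map :: "(complex \<Rightarrow> complex) \<Rightarrow> bool" where
  "rational_map f \<longleftrightarrow>
     (\<exists>p q :: complex poly. q \<noteq> 0 \<and> (\<forall>z. poly q z \<noteq> 0 \<longrightarrow> f z = poly p z / poly q z))"

definition transcendental_meromorphic :: "(complex \<Rightarrow> complex) \<Rightarrow> bool" where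
  "transcendental_meromorphic f \<longleftrightarrow> f nicely_meromorphic_on UNIV \<and> \<not> rational_map f"

text \<open>
  Inverse stereographic projection onto the unit sphere of \<open>\<complex> \<times> \<real>\<close>, whose north pole
  \<open>(0, 1)\<close> is the point at infinity. The distance of the images is the chordal metric.
\<close>

definition to_sphere :: "complex \<Rightarrow> complex \<times> real" where
  "to_sphere z = ((2 / (1 + (norm z)\<^sup>2)) *\<^sub>R z, ((norm z)\<^sup>2 - 1) / ((norm z)\<^sup>2 + 1))"

text \<open>
  Normality in the sense of Montel, for open \<open>D\<close>: every sequence in the family has a subsequence
  converging in the chordal metric locally uniformly on \<open>D\<close>. The sphere is closed, so \<open>g\<close>
  automatically takes values in it; in particular convergence to infinity is allowed.
\<close>

definition normal_family_on :: "complex set \<Rightarrow> (complex \<Rightarrow> complex) set \<Rightarrow> bool" where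
  "normal_family_on D \<F> \<longleftrightarrow>
     (\<forall>s :: nat \<Rightarrow> complex \<Rightarrow> complex. range s \<subseteq> \<F> \<longrightarrow>
        (\<exists>r g. strict_mono r \<and>
           (\<forall>K. compact K \<and> K \<subseteq> D \<longrightarrow>
              uniform_limit K (\<lambda>k z. to_sphere (s (r k) z)) g sequentially)))"

text \<open>
  All iterates are defined at \<open>w\<close> iff no point of the orbit of \<open>w\<close> is a pole; then \<open>(f ^^ n) w\<close>
  is the true \<open>n\<close>-th iterate.
\<close>

definition Fatou_set :: "(complex \<Rightarrow> complex) \<Rightarrow> complex set" where
  "Fatou_set f = {z. \<exists>N. open N \<and> z \<in> N \<and>
     (\<forall>w\<in>N. \<forall>n. \<not> is_pole f ((f ^^ n) w)) \<and>
     normal_family_on N (range (\<lambda>n. f ^^ n))}"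

definition Fatou_component :: "(complex \<Rightarrow> complex) \<Rightarrow> complex set \<Rightarrow> bool" where
  "Fatou_component f U \<longleftrightarrow> U \<in> components (Fatou_set f)"

definition invariant_Baker_domain :: "(complex \<Rightarrow> complex) \<Rightarrow> complex set \<Rightarrow> bool" where
  "invariant_Baker_domain f U \<longleftrightarrow>
     Fatou_component f U \<and> f ` U \<subseteq> U \<and>
     (\<forall>z\<in>U. filterlim (\<lambda>n. (f ^^ n) z) at_infinity sequentially)"

definition critical_point :: "(complex \<Rightarrow> complex) \<Rightarrow> complex \<Rightarrow> bool" where
  "critical_point f c \<longleftrightarrow> (\<forall>N. open N \<and> c \<in> N \<longrightarrow> \<not> inj_on f N)"

definition finite_critical_value :: "(complex \<Rightarrow> complex) \<Rightarrow> complex \<Rightarrow> bool" where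
  "finite_critical_value f a \<longleftrightarrow> (\<exists>c. critical_point f c \<and> \<not> is_pole f c \<and> f c = a)"

definition finite_asymptotic_value :: "(complex \<Rightarrow> complex) \<Rightarrow> complex \<Rightarrow> bool" where
  "finite_asymptotic_value f a \<longleftrightarrow>
     (\<exists>\<gamma> :: real \<Rightarrow> complex. continuous_on {0..} \<gamma> \<and> filterlim \<gamma> at_infinity at_top \<and>
        (\<forall>\<^sub>F t in at_top. \<not> is_pole f (\<gamma> t)) \<and> ((\<lambda>t. f (\<gamma> t)) \<longlongrightarrow> a) at_top)"

definition sing_inverse :: "(complex \<Rightarrow> complex) \<Rightarrow> complex set" where
  "sing_inverse f = {a. finite_critical_value f a \<or> finite_asymptotic_value f a}"

definition super_attracting_period_2 :: "(complex \<Rightarrow> complex) \<Rightarrow> complex \<Rightarrow> bool" where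
  "super_attracting_period_2 f z \<longleftrightarrow>
     \<not> is_pole f z \<and> f z \<noteq> z \<and>
     \<not> is_pole f (f z) \<and> (f ^^ 2) z = z \<and> deriv (f ^^ 2) z = 0"

end

theory Submission
  imports Defs
begin

text \<open>
  Fix \<open>l \<ge> 32 + 8 * \<rho>\<close>. The function is \<open>l * z\<close> plus tiny rational terms whose poles lie in the discs
  \<open>island l k\<close> about \<open>l ^ k\<close>. Outside slightly larger discs it differs from \<open>l * z\<close> by at most 1, so
  the complement of these discs (inside \<open>norm z > 1\<close>) is mapped into itself and escapes uniformly;
  the Fatou component containing it is the Baker domain, and it contains the annuli between
  consecutive discs.

  The terms are added one disc at a time. Critical points \<open>c\<close> in the \<open>n\<close>-th disc have their values
  \<open>v\<close> in the next one. A term \<open>h\<close> with poles very close to these \<open>v\<close> can be given the values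
  \<open>h v = c - f v\<close>, be arbitrarily small elsewhere, and vanish to high order at all
  critical points found so far and at the earlier critical values. Hence \<open>f + h\<close> exchanges \<open>v\<close> and \<open>c\<close>,
  earlier cycles persist exactly, and no critical points arise except near the new poles. There
  \<open>h' / h\<close> is huge, so \<open>h\<close> is small where \<open>h'\<close> is bounded, and the new critical
  values lie in the disc after that. In the limit every critical value is super-attracting of period
  2; there are no finite asymptotic values, as a path to infinity must cross the annuli,
  where the function is large.
\<close>

section \<open>Small functions with poles near prescribed points\<close>

text \<open>The cycles must close up exactly although infinitely many corrections are added, and no
  critical point may appear only in the limit. Both are controlled through the derivative. On a disc
  containing all old critical points a correction \<open>h\<close> must satisfy
  \<open>|h'| \<le> (1 / 2) ^ (n + 2) * |f'|\<close>, even near zeros of \<open>f'\<close>. A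
  Lojasiewicz-type inequality bounds a power of the polynomial with these zeros by a multiple of
  \<open>|f'|\<close>, and \<open>h\<close> gets a high power of that polynomial as a factor. The
  factors \<open>1 - (1 / 2) ^ (n + 2)\<close> have a product of at least 1/2, so a zero of the
  limit derivative is already a zero at a finite stage. New poles may bring new critical points
  \<open>c\<close> near them. Their values differ from \<open>l * c\<close> by at most 2: at most 1
  from the old function and 1 from \<open>h\<close>. The radius \<open>l ^ k / 8 - 1\<close> leaves
  a margin 1 that multiplication by \<open>l\<close> enlarges to \<open>l\<close>, enough to absorb
  this error together with a unit disc for the next poles. The term \<open>8 * \<rho>\<close> comes
  from the annuli between \<open>4 * l ^ j\<close> and \<open>l ^ Suc j / 2\<close>, whose radii
  have ratio \<open>l / 8\<close>; the bound 32 is a convenient choice that keeps consecutive discs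
  well apart.\<close>

lemma deriv_bound_by_sup:
  fixes h :: "complex \<Rightarrow> complex"
  assumes "h holomorphic_on S" "cball z r \<subseteq> S" "r > 0" "\<And>x. x \<in> cball z r \<Longrightarrow> norm (h x) \<le> B"
  shows "norm (deriv h z) \<le> B / r"
proof -
  have "h holomorphic_on cball z r"
    using assms holomorphic_on_subset by blast
  then have "norm ((deriv ^^ 1) h z) \<le> fact 1 * B / r ^ 1"
    by (intro Cauchy_inequality)
       (use assms in \<open>auto simp: dist_norm intro: holomorphic_on_imp_continuous_on holomorphic_on_subset\<close>)
  then show ?thesis by simp
qed

text \<open>Supplies the harmless part of a logarithmic derivative: near \<open>v\<close> the
  polynomial factor contributes a bounded term, which a pole close enough to \<open>v\<close>
  outweighs.\<close>

lemma log_deriv_finite_prod_bound: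
  fixes Z :: "complex set"
  assumes "finite Z" "v \<notin> Z"
  obtains \<rho>0 \<Lambda> where "\<rho>0 > 0" "\<Lambda> \<ge> 0"
    "\<And>z. z \<in> cball v \<rho>0 \<Longrightarrow> (\<Prod>\<zeta>\<in>Z. z - \<zeta>) \<noteq> 0 \<and>
        norm (deriv (\<lambda>z. \<Prod>\<zeta>\<in>Z. z - \<zeta>) z / (\<Prod>\<zeta>\<in>Z. z - \<zeta>)) \<le> \<Lambda>"
proof -
  define Q where "Q = (\<lambda>z::complex. \<Prod>\<zeta>\<in>Z. z - \<zeta>)"
  have hol: "Q holomorphic_on UNIV"
    unfolding Q_def by (intro holomorphic_intros)
  have hol': "deriv Q holomorphic_on A" for A
    using holomorphic_deriv[OF hol open_UNIV] by (rule holomorphic_on_subset) simp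
  obtain \<rho>0 where \<rho>0: "\<rho>0 > 0" "cball v \<rho>0 \<subseteq> - Z"
    using assms finite_imp_closed[of Z] open_contains_cball[of "-Z"] by auto
  have nz: "Q z \<noteq> 0" if "z \<in> cball v \<rho>0" for z
    using that \<rho>0 assms by (auto simp: Q_def prod_zero_iff)
  have "continuous_on (cball v \<rho>0) (\<lambda>z. deriv Q z / Q z)"
    using nz holomorphic_on_subset[OF hol, of "cball v \<rho>0"] hol'
    by (intro holomorphic_on_imp_continuous_on holomorphic_on_divide) auto
  then have "bounded ((\<lambda>z. deriv Q z / Q z) ` cball v \<rho>0)"
    by (intro compact_imp_bounded compact_continuous_image) auto
  then obtain \<Lambda> where "\<And>z. z \<in> cball v \<rho>0 \<Longrightarrow> norm (deriv Q z / Q z) \<le> \<Lambda>"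
    by (metis (no_types, lifting) bounded_iff imageI)
  moreover from this[of v] have "\<Lambda> \<ge> 0" using \<rho>0(1)
    by (metis centre_in_cball less_eq_real_def norm_ge_zero order_trans)
  ultimately show ?thesis
    using that[of \<rho>0 \<Lambda>] \<rho>0 nz unfolding Q_def by blast
qed

text \<open>The function is a constant times \<open>Q ^ Suc M * (\<delta> / (z - b)) ^ m\<close>
  with \<open>b = v - \<delta>\<close>. Its value at \<open>v\<close> does not depend on
  \<open>\<delta>\<close>, while away from \<open>v\<close> it is of order \<open>\<delta>\<close>.
  The last conclusion holds near \<open>v\<close> because the logarithmic derivative is large
  there.\<close>

lemma single_pole_bump:
  fixes v g :: complex and Z :: "complex set" and M :: nat and X :: real
  assumes Z: "finite Z" "v \<notin> Z" and g: "g \<noteq> 0"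
    and pos: "e > 0" "r > 0" "T > 0" "w > 0"
  obtains h b where "b \<in> ball v r" "b \<noteq> v" "h holomorphic_on - {b}" "is_pole h b" "h v = g"
    "\<And>\<zeta>. \<zeta> \<in> Z \<Longrightarrow> h \<zeta> = 0"
    "\<And>z. z \<notin> ball v r \<Longrightarrow> norm (h z) \<le> e \<and> norm (deriv h z) \<le> e"
    "\<And>z. z \<in> cball 0 X - ball v r \<Longrightarrow> norm (deriv h z) \<le> e * norm (\<Prod>\<zeta>\<in>Z. z - \<zeta>) ^ M"
    "\<And>z. z \<noteq> b \<Longrightarrow> norm (deriv h z) \<le> T \<Longrightarrow> norm (h z) \<le> w"
proof -
  define Q where "Q = (\<lambda>z::complex. \<Prod>\<zeta>\<in>Z. z - \<zeta>)"
  have holQ: "Q holomorphic_on A" for A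
    unfolding Q_def by (intro holomorphic_intros)
  have holdQ: "deriv Q holomorphic_on A" for A
    using holomorphic_deriv[OF holQ open_UNIV] by (rule holomorphic_on_subset) simp
  have Qv: "Q v \<noteq> 0" using Z by (auto simp: Q_def prod_zero_iff)
  define A where "A = g / Q v ^ Suc M"
  have A: "A \<noteq> 0" using g Qv by (auto simp: A_def)
  define m where "m = Suc M * card Z + 1"
  obtain \<rho>0 \<Lambda> where \<rho>0: "\<rho>0 > 0" "\<Lambda> \<ge> 0" and \<Lambda>:
    "\<And>z. z \<in> cball v \<rho>0 \<Longrightarrow> Q z \<noteq> 0 \<and> norm (deriv Q z / Q z) \<le> \<Lambda>"
    using log_deriv_finite_prod_bound[OF Z] unfolding Q_def by metis
  \<comment> \<open>The first three entries keep the construction inside \<open>ball v r\<close>,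
    inside the region where \<open>\<Lambda>\<close> applies, and below 1. The last makes the
    polynomial part of \<open>h' / h\<close> at most \<open>1 / (8 * r1)\<close>; the fourth then
    turns \<open>|h'| \<le> T\<close> into \<open>|h| \<le> w\<close>.\<close>
  define r1 where "r1 = Min {r, \<rho>0, 1, w / (8 * T), 1 / (8 * (Suc M * \<Lambda> + 1))}"
  have r1: "r1 > 0" "r1 \<le> r" "r1 \<le> \<rho>0" "r1 \<le> 1" "r1 \<le> w / (8 * T)" "r1 \<le> 1 / (8 * (Suc M * \<Lambda> + 1))"
  proof -
    have "Suc M * \<Lambda> + 1 > 0" using \<rho>0 by (simp add: add_nonneg_pos)
    then have "1 / (8 * (Suc M * \<Lambda> + 1)) > 0" by (intro divide_pos_pos) auto
    then show "r1 > 0" using pos \<rho>0 unfolding r1_def by (subst Min_gr_iff) auto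
  qed (unfold r1_def, (rule Min_le, simp, simp)+)
  have "bounded Z" using Z by (simp add: finite_imp_bounded)
  then obtain D where D: "\<And>\<zeta>. \<zeta> \<in> Z \<Longrightarrow> norm (v - \<zeta>) \<le> D" "D \<ge> 0"
    by (metis bounded_any_center[of Z v] dist_norm abs_ge_zero abs_ge_self order_trans)
  \<comment> \<open>\<open>K\<close> compares \<open>z - \<zeta>\<close> with \<open>z - b\<close>
    at distance at least \<open>r1 / 2\<close> from \<open>v\<close>. There
    \<open>C1 * \<delta>\<close> will bound \<open>h\<close> and \<open>C2 * \<delta>\<close> its
    singular factor \<open>k\<close>.\<close>
  define K where "K = 2 * (1 + 2 * D / r1)"
  have K: "K \<ge> 1" using D r1 by (auto simp: K_def)
  define C1 where "C1 = norm A * K ^ (Suc M * card Z) * (4 / r1)"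
  have C1: "C1 \<ge> 0" using K r1 by (auto simp: C1_def)
  define C2 where "C2 = norm A * (4 / r1)"
  have C2: "C2 \<ge> 0" using r1 by (auto simp: C2_def)
  have "bounded ((\<lambda>z. (norm (Q z), norm (deriv Q z))) ` cball 0 X)"
    by (intro compact_imp_bounded compact_continuous_image continuous_intros
        holomorphic_on_imp_continuous_on holQ holdQ) auto
  then obtain q where q: "\<And>z. z \<in> cball 0 X \<Longrightarrow> norm (norm (Q z), norm (deriv Q z)) \<le> q"
    by (metis (no_types, lifting) bounded_iff imageI)
  define q' where "q' = \<bar>q\<bar>"
  have q': "norm (Q z) \<le> q'" "norm (deriv Q z) \<le> q'" if "z \<in> cball 0 X" for z
    using q[OF that] norm_fst_le[of "norm (Q z)" "norm (deriv Q z)"]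
      norm_snd_le[of "norm (deriv Q z)" "norm (Q z)"] by (auto simp: q'_def)
  have q'0: "q' \<ge> 0" by (simp add: q'_def)
  \<comment> \<open>\<open>B * \<delta>\<close> dominates the bounds for \<open>h\<close>, for
    \<open>h'\<close> (Cauchy estimate with radius \<open>r1 / 2\<close>) and for the cofactor of
    \<open>Q ^ M\<close> in \<open>h'\<close>, so that a single choice of \<open>\<delta>\<close>
    serves all three.\<close>
  define B where "B = C1 + C1 / (r1 / 2) + Suc M * q' * C2 + q' * (C2 / (r1 / 2)) + 1"
  have Bpos: "B > 0" "B \<ge> C1" "B \<ge> C1 / (r1 / 2)" "B \<ge> Suc M * q' * C2 + q' * (C2 / (r1 / 2))"
  proof -
    have a: "C1 / (r1 / 2) \<ge> 0" "Suc M * q' * C2 \<ge> 0" "q' * (C2 / (r1 / 2)) \<ge> 0"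
      using C1 C2 q'0 r1 by (auto intro!: mult_nonneg_nonneg divide_nonneg_pos)
    then show "B > 0" "B \<ge> C1" "B \<ge> C1 / (r1 / 2)" "B \<ge> Suc M * q' * C2 + q' * (C2 / (r1 / 2))"
      using C1 unfolding B_def by linarith+
  qed
  define \<delta> where "\<delta> = min (r1 / 4) (min e w / B)"
  have \<delta>: "\<delta> > 0" "\<delta> \<le> r1 / 4" "\<delta> * B \<le> e" "\<delta> \<le> 1" "\<delta> * B \<le> w"
  proof -
    show "\<delta> > 0" using r1 pos Bpos by (auto simp: \<delta>_def)
    show "\<delta> \<le> r1 / 4" unfolding \<delta>_def by (rule min.cobounded1)
    then show "\<delta> \<le> 1" using r1 by linarith
    have "\<delta> \<le> min e w / B" unfolding \<delta>_def by (rule min.cobounded2)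
    then have "\<delta> * B \<le> min e w" using Bpos by (simp add: pos_le_divide_eq)
    then show "\<delta> * B \<le> e" "\<delta> * B \<le> w" by auto
  qed
  define b where "b = v - of_real \<delta>"
  define k where "k = (\<lambda>z. A * (of_real \<delta> / (z - b)) ^ m)"
  \<comment> \<open>The exponent \<open>m\<close> exceeds the degree of \<open>Q ^ Suc M\<close>, so \<open>h\<close> vanishes at infinity; and \<open>v - b = \<delta>\<close>
    makes the factor in \<open>k\<close> equal to 1 at \<open>v\<close>.\<close>
  define h where "h = (\<lambda>z. Q z ^ Suc M * k z)"
  have distb: "norm (z - b) \<ge> norm (z - v) / 2" "norm (z - b) \<ge> r1 / 4" if "norm (z - v) \<ge> r1 / 2" for z
  proof -
    have "norm (z - v) \<le> norm (z - b) + \<delta>"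
      using norm_triangle_ineq4[of "z - b" "of_real \<delta>"] \<delta> by (simp add: b_def)
    then show "norm (z - b) \<ge> norm (z - v) / 2" "norm (z - b) \<ge> r1 / 4" using \<delta> that by linarith+
  qed
  have holk: "k holomorphic_on - {b}"
    unfolding k_def by (intro holomorphic_intros) auto
  have holh: "h holomorphic_on - {b}"
    unfolding h_def by (intro holomorphic_intros holk holQ)
  have kbound: "norm (k z) \<le> C2 * \<delta>" if "norm (z - v) \<ge> r1 / 2" for z
  proof -
    have "\<delta> / norm (z - b) \<le> \<delta> / (r1 / 4)"
      using distb[OF that] \<delta> r1 by (intro divide_left_mono mult_pos_pos) auto
    moreover have "\<delta> / (r1 / 4) \<le> 1" using \<delta> r1 by (simp add: divide_le_eq)
    ultimately have *: "\<delta> / norm (z - b) \<le> \<delta> / (r1 / 4)" "\<delta> / norm (z - b) \<le> 1" by auto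
    have "(\<delta> / norm (z - b)) ^ m \<le> (\<delta> / norm (z - b)) ^ 1"
      using * \<delta> by (intro power_decreasing) (auto simp: m_def)
    also have "\<dots> \<le> \<delta> / (r1 / 4)" using * by simp
    finally have "norm A * (\<delta> / norm (z - b)) ^ m \<le> norm A * (\<delta> / (r1 / 4))"
      by (intro mult_left_mono) auto
    then show ?thesis using \<delta> by (simp add: k_def norm_mult norm_power norm_divide C2_def mult_ac)
  qed
  have hbound: "norm (h z) \<le> C1 * \<delta>" if zv: "norm (z - v) \<ge> r1 / 2" for z
  proof -
    have nb: "norm (z - b) > 0" using distb[OF that] r1 by linarith
    have "norm (z - \<zeta>) \<le> K * norm (z - b)" if "\<zeta> \<in> Z" for \<zeta>
    proof -
      have "norm (z - \<zeta>) \<le> norm (z - v) + norm (v - \<zeta>)"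
        using norm_triangle_ineq[of "z - v" "v - \<zeta>"] by simp
      also have "\<dots> \<le> norm (z - v) + D" using D(1)[OF that] by simp
      also have "D \<le> norm (z - v) * (2 * D / r1)"
      proof -
        have "(r1 / 2) * (2 * D / r1) \<le> norm (z - v) * (2 * D / r1)"
          using zv D r1 by (intro mult_right_mono) auto
        then show ?thesis using r1 by simp
      qed
      also have "norm (z - v) + norm (z - v) * (2 * D / r1) = norm (z - v) * (1 + 2 * D / r1)"
        by (simp add: algebra_simps)
      also have "\<dots> \<le> (2 * norm (z - b)) * (1 + 2 * D / r1)"
        using distb[OF zv] D r1 by (intro mult_right_mono) auto
      finally show ?thesis by (simp add: K_def algebra_simps)
    qed
    then have "norm (Q z) \<le> (\<Prod>\<zeta>\<in>Z. K * norm (z - b))"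
      unfolding Q_def prod_norm[symmetric] by (intro prod_mono) auto
    then have "norm (Q z) \<le> (K * norm (z - b)) ^ card Z" by simp
    then have "norm (Q z) ^ Suc M \<le> ((K * norm (z - b)) ^ card Z) ^ Suc M"
      by (rule power_mono) auto
    also have "\<dots> = (K * norm (z - b)) ^ (Suc M * card Z)"
      by (metis power_mult mult.commute)
    finally have "norm (h z) \<le> (K * norm (z - b)) ^ (Suc M * card Z) * (norm A * (\<delta> / norm (z - b)) ^ m)"
      using \<delta> K unfolding h_def k_def norm_mult norm_power norm_divide
      by (intro mult_mono) (auto intro!: mult_nonneg_nonneg zero_le_power)
    also have "\<dots> = norm A * K ^ (Suc M * card Z) * \<delta> ^ m / norm (z - b)"
      using nb by (simp add: m_def power_mult_distrib power_divide del: mult_Suc)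
    also have "\<dots> \<le> norm A * K ^ (Suc M * card Z) * \<delta> ^ m / (r1 / 4)"
      using distb[OF zv] r1 K \<delta> by (intro divide_left_mono) (auto intro!: mult_nonneg_nonneg mult_pos_pos simp: nb)
    also have "\<dots> \<le> norm A * K ^ (Suc M * card Z) * \<delta> ^ 1 / (r1 / 4)"
      using \<delta> r1 K by (intro divide_right_mono mult_left_mono power_decreasing) (auto simp: m_def)
    finally show ?thesis by (simp add: C1_def mult_ac)
  qed
  have far: "cball z (r1 / 2) \<subseteq> - {b}" "\<And>x. x \<in> cball z (r1 / 2) \<Longrightarrow> norm (x - v) \<ge> r1 / 2"
    if "z \<notin> ball v r1" for z
  proof -
    show *: "norm (x - v) \<ge> r1 / 2" if "x \<in> cball z (r1 / 2)" for x
      using that \<open>z \<notin> ball v r1\<close> norm_triangle_ineq4[of "x - v" "x - z"]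
      by (auto simp: dist_norm norm_minus_commute)
    show "cball z (r1 / 2) \<subseteq> - {b}" using * distb r1 by fastforce
  qed
  have dh: "norm (deriv h z) \<le> C1 * \<delta> / (r1 / 2)" if "z \<notin> ball v r1" for z
    using far[OF that] hbound holh r1 by (intro deriv_bound_by_sup[where S = "-{b}"]) auto
  have dk: "norm (deriv k z) \<le> C2 * \<delta> / (r1 / 2)" if "z \<notin> ball v r1" for z
    using far[OF that] kbound holk r1 by (intro deriv_bound_by_sup[where S = "-{b}"]) auto
  have derQ: "(Q has_field_derivative deriv Q z) (at z)" for z
    using holQ[of UNIV] by (simp add: holomorphic_derivI)
  have derk: "(k has_field_derivative deriv k z) (at z)" if "z \<noteq> b" for z
    using holk that by (intro holomorphic_derivI[where S = "-{b}"]) auto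
  \<comment> \<open>The exponent \<open>Suc M\<close> in \<open>h\<close> leaves the factor
    \<open>Q ^ M\<close> after differentiation, as the weighted bound on \<open>h'\<close>
    requires.\<close>
  have derh: "deriv h z = Q z ^ M * (Suc M * deriv Q z * k z + Q z * deriv k z)" if "z \<noteq> b" for z
    unfolding h_def
    by (rule DERIV_imp_deriv, (rule derivative_eq_intros derQ derk that refl)+)
       (simp add: algebra_simps)
  have derk': "deriv k z = - of_nat m * k z / (z - b)" if "z \<noteq> b" for z
  proof -
    obtain m' where m': "m = Suc m'" by (simp add: m_def)
    have nz: "z - b \<noteq> 0" using that by simp
    have "((\<lambda>z. of_real \<delta> / (z - b)) has_field_derivative - of_real \<delta> / (z - b) ^ 2) (at z)"
      using nz by (auto intro!: derivative_eq_intros simp: power2_eq_square)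
    then have "((\<lambda>z. A * (of_real \<delta> / (z - b)) ^ m) has_field_derivative
        A * (of_nat m * (- of_real \<delta> / (z - b) ^ 2 * (of_real \<delta> / (z - b)) ^ (m - Suc 0)))) (at z)"
      by (intro DERIV_cmult DERIV_power)
    then have "deriv k z = A * (of_nat m * (- of_real \<delta> / (z - b) ^ 2 * (of_real \<delta> / (z - b)) ^ (m - Suc 0)))"
      unfolding k_def by (rule DERIV_imp_deriv)
    also have "\<dots> = - of_nat m * k z / (z - b)"
      using nz by (simp add: k_def m' power2_eq_square del: of_nat_Suc)
    finally show ?thesis .
  qed
  show ?thesis
  proof (rule that[of b h])
    show "b \<in> ball v r" "b \<noteq> v" using \<delta> r1 by (auto simp: b_def dist_norm)
    show "h holomorphic_on - {b}" by (rule holh)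
    have "b \<in> cball v \<rho>0" using \<delta> r1 by (auto simp: b_def dist_norm)
    then have Qb: "Q b \<noteq> 0" using \<Lambda> by blast
    have "is_pole (\<lambda>z. (Q z ^ Suc M * A * of_real \<delta> ^ m) / (z - b) ^ m) b"
      by (rule is_pole_basic[of _ UNIV])
         (use Qb A \<delta> in \<open>auto intro!: holomorphic_intros holQ simp: m_def\<close>)
    then show "is_pole h b" by (simp add: h_def k_def power_divide mult_ac)
    show "h v = g" using \<delta> Qv by (simp add: h_def k_def b_def A_def)
    show "h \<zeta> = 0" if "\<zeta> \<in> Z" for \<zeta>
      using that Z by (auto simp: h_def Q_def)
  next
    fix z assume "z \<notin> ball v r"
    then have z: "z \<notin> ball v r1" "z \<noteq> b" using r1 \<delta> by (auto simp: b_def dist_norm)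
    have "norm (h z) \<le> C1 * \<delta>" using z r1 by (intro hbound) (auto simp: dist_norm norm_minus_commute)
    also have "\<dots> \<le> B * \<delta>" using Bpos \<delta> by (intro mult_right_mono) auto
    finally have 1: "norm (h z) \<le> e" using \<delta> by (simp add: mult_ac)
    have "norm (deriv h z) \<le> (C1 / (r1 / 2)) * \<delta>" using dh[OF z(1)] by (simp add: mult_ac)
    also have "\<dots> \<le> B * \<delta>" using Bpos \<delta> by (intro mult_right_mono) auto
    finally show "norm (h z) \<le> e \<and> norm (deriv h z) \<le> e" using 1 \<delta> by (simp add: mult_ac)
  next
    fix z assume "z \<in> cball 0 X - ball v r"
    then have z: "z \<in> cball 0 X" "z \<notin> ball v r1" "z \<noteq> b" using r1 \<delta> by (auto simp: b_def dist_norm)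
    have "norm (Suc M * deriv Q z * k z + Q z * deriv k z)
        \<le> norm (Suc M * deriv Q z * k z) + norm (Q z * deriv k z)" by (rule norm_triangle_ineq)
    also have "\<dots> = Suc M * norm (deriv Q z) * norm (k z) + norm (Q z) * norm (deriv k z)"
      by (simp only: norm_mult norm_of_nat)
    also have "\<dots> \<le> Suc M * q' * (C2 * \<delta>) + q' * (C2 * \<delta> / (r1 / 2))"
      using z r1 q' q'0 dk[OF z(2)] kbound
      by (intro add_mono mult_mono mult_nonneg_nonneg) (auto simp: dist_norm norm_minus_commute)
    also have "\<dots> = (Suc M * q' * C2 + q' * (C2 / (r1 / 2))) * \<delta>"
      by (simp add: algebra_simps)
    also have "\<dots> \<le> B * \<delta>" using Bpos \<delta> by (intro mult_right_mono) auto
    also have "\<dots> \<le> e" using \<delta> by (simp add: mult_ac)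
    finally have "norm (Q z) ^ M * norm (Suc M * deriv Q z * k z + Q z * deriv k z) \<le> norm (Q z) ^ M * e"
      by (intro mult_left_mono) auto
    then show "norm (deriv h z) \<le> e * norm (\<Prod>\<zeta>\<in>Z. z - \<zeta>) ^ M"
      unfolding derh[OF z(3)] by (simp add: norm_mult norm_power Q_def mult_ac)
  next
    fix z assume z: "z \<noteq> b" and dT: "norm (deriv h z) \<le> T"
    show "norm (h z) \<le> w"
    proof (cases "z \<in> ball v r1")
      case False
      then have "norm (h z) \<le> C1 * \<delta>" using r1 by (intro hbound) (auto simp: dist_norm norm_minus_commute)
      also have "\<dots> \<le> B * \<delta>" using Bpos \<delta> by (intro mult_right_mono) auto
      finally show ?thesis using \<delta> by (simp add: mult_ac)
    next
      case True
      have Qz: "Q z \<noteq> 0" "norm (deriv Q z / Q z) \<le> \<Lambda>" using True r1 \<Lambda>[of z] by auto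
      have hz: "h z = Q z * Q z ^ M * k z" by (simp add: h_def)
      \<comment> \<open>In \<open>h' / h\<close> the pole contributes at least
        \<open>1 / (2 * r1)\<close>, since \<open>|z - b| \<le> 2 * r1\<close> and
        \<open>m \<ge> 1\<close>, and the polynomial at most \<open>1 / (8 * r1)\<close>; hence
        \<open>|h| \<le> 4 * r1 * |h'|\<close>.\<close>
      have "deriv h z = h z * (Suc M * (deriv Q z / Q z) - m / (z - b))"
        unfolding derh[OF z] derk'[OF z] hz using Qz z by (simp add: field_simps)
      moreover have "norm (m / (z - b) - Suc M * (deriv Q z / Q z)) \<ge> 1 / (4 * r1)"
      proof -
        have "norm (z - b) \<le> norm (z - v) + \<delta>"
          using norm_triangle_ineq[of "z - v" "of_real \<delta>"] \<delta> by (simp add: b_def algebra_simps)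
        also have "\<dots> \<le> 2 * r1" using True \<delta> r1 by (auto simp: dist_norm norm_minus_commute)
        finally have "1 / (2 * r1) \<le> m / norm (z - b)"
          using z by (intro frac_le) (auto simp: m_def)
        moreover have "Suc M * norm (deriv Q z / Q z) \<le> Suc M * \<Lambda>"
          using Qz by (intro mult_left_mono) auto
        moreover have "Suc M * \<Lambda> \<le> 1 / (8 * r1)"
        proof -
          have "Suc M * \<Lambda> + 1 > 0" using \<rho>0 by (simp add: add_nonneg_pos)
          then have "r1 * (8 * (Suc M * \<Lambda> + 1)) \<le> 1"
            using r1(6) by (subst (asm) pos_le_divide_eq) auto
          then have "r1 * (8 * (Suc M * \<Lambda>)) \<le> 1" using r1(1) by (simp add: algebra_simps)
          then show ?thesis using r1(1) by (simp add: field_simps)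
        qed
        moreover have "norm (m / (z - b)) - norm (Suc M * (deriv Q z / Q z)) \<le> norm (m / (z - b) - Suc M * (deriv Q z / Q z))"
          by (rule norm_triangle_ineq2)
        moreover have "norm (m / (z - b)) = m / norm (z - b)" by (simp add: norm_divide)
        moreover have "norm (Suc M * (deriv Q z / Q z)) = Suc M * norm (deriv Q z / Q z)"
          by (simp only: norm_mult norm_of_nat)
        moreover have "1 / (2 * r1) - 1 / (8 * r1) \<ge> 1 / (4 * r1)" using r1(1) by (simp add: field_simps)
        ultimately show ?thesis by linarith
      qed
      ultimately have "norm (h z) * (1 / (4 * r1)) \<le> norm (deriv h z)"
        by (simp only: norm_mult) (intro mult_left_mono, simp_all only: norm_minus_commute norm_ge_zero)
      then have "norm (h z) \<le> 4 * r1 * norm (deriv h z)" using r1(1) by (simp add: field_simps)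
      also have "\<dots> \<le> 4 * r1 * T" using dT r1(1) by (intro mult_left_mono) auto
      also have "\<dots> \<le> w" using r1(5) pos by (simp add: field_simps)
      finally show ?thesis .
    qed
  qed
qed

lemma is_pole_add_analytic:
  fixes f h :: "complex \<Rightarrow> complex"
  assumes "is_pole f p" "h analytic_on {p}"
  shows "is_pole (\<lambda>z. f z + h z) p" "is_pole (\<lambda>z. h z + f z) p"
proof -
  have "h \<midarrow>p\<rightarrow> h p"
    using analytic_at_imp_isCont[OF assms(2)] by (simp add: isCont_def)
  then show "is_pole (\<lambda>z. h z + f z) p"
    using assms(1) unfolding is_pole_def by (rule tendsto_add_filterlim_at_infinity)
  then show "is_pole (\<lambda>z. f z + h z) p" by (simp add: add.commute)
qed

lemma holomorphic_analytic_at: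
  assumes "finite P" "h holomorphic_on - P" "p \<notin> P"
  shows "h analytic_on {p}"
  using assms by (metis Compl_iff analytic_on_holomorphic bot_least finite_imp_closed insert_subset open_Compl)

lemma deriv_add_off_poles:
  assumes "finite P" "h holomorphic_on - P" "finite P'" "k holomorphic_on - P'" "z \<notin> P" "z \<notin> P'"
  shows "deriv (\<lambda>z. h z + k z) z = deriv h z + deriv k z"
  using assms by (intro deriv_add) (auto intro: holomorphic_on_imp_differentiable_at finite_imp_closed)

text \<open>Induction over \<open>V\<close>: the bump added at a new point \<open>v\<close> also
  vanishes on the earlier points, so their values survive, and its value at \<open>v\<close>
  compensates for what the earlier bumps contribute there.\<close>

lemma poles_bump:
  fixes g :: "complex \<Rightarrow> complex" and Z V :: "complex set" and M :: nat and X :: real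
  assumes V: "finite V" and Z: "finite Z" "V \<inter> Z = {}" and g: "\<And>v. v \<in> V \<Longrightarrow> g v \<noteq> 0"
    and pos: "e > 0" "r > 0" "T > 0" "w > 0"
  shows "\<exists>h P. finite P \<and> P \<subseteq> (\<Union>v\<in>V. ball v r) \<and> P \<inter> V = {} \<and> (V \<noteq> {} \<longrightarrow> P \<noteq> {}) \<and>
    h holomorphic_on - P \<and> (\<forall>p\<in>P. is_pole h p) \<and> (\<forall>v\<in>V. h v = g v) \<and> (\<forall>\<zeta>\<in>Z. h \<zeta> = 0) \<and>
    (\<forall>z. z \<notin> (\<Union>v\<in>V. ball v r) \<longrightarrow> norm (h z) \<le> e \<and> norm (deriv h z) \<le> e) \<and>
    (\<forall>z \<in> cball 0 X - (\<Union>v\<in>V. ball v r). norm (deriv h z) \<le> e * norm (\<Prod>\<zeta>\<in>Z. z - \<zeta>) ^ M) \<and>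
    (\<forall>z. z \<notin> P \<longrightarrow> norm (deriv h z) \<le> T \<longrightarrow> norm (h z) \<le> w)"
  using assms
proof (induction V arbitrary: e r T w rule: finite_induct)
  case empty
  then show ?case by (intro exI[of _ "\<lambda>_. 0"] exI[of _ "{}"]) auto
next
  case (insert v V)
  define r1 where "r1 = min r (infdist v V / 2)"
  have r1V: "ball v r1 \<inter> ball v' r1 = {}" "v \<notin> ball v' r1" if "v' \<in> V" for v'
  proof -
    have "2 * r1 \<le> infdist v V" by (simp add: r1_def)
    also have "\<dots> \<le> dist v v'" using that by (rule infdist_le)
    finally have *: "2 * r1 \<le> dist v v'" .
    then show "ball v r1 \<inter> ball v' r1 = {}" by (intro disjoint_ballI) auto
    show "v \<notin> ball v' r1" using * zero_le_dist[of v v'] by (auto simp: dist_commute simp del: zero_le_dist)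
  qed
  have r1: "r1 \<le> r" by (simp add: r1_def)
  have r1pos: "r1 > 0 \<or> V = {}" 
    using insert.prems insert.hyps infdist_pos_not_in_closed[of V v]
    by (auto simp: r1_def finite_imp_closed)
  \<comment> \<open>For empty \<open>V\<close> the library value \<open>infdist v {} = 0\<close>
    makes \<open>r1\<close> zero, hence the case distinction.\<close>
  define r2 where "r2 = (if V = {} then r else r1)"
  have r2: "r2 > 0" "r2 \<le> r" "\<And>v'. v' \<in> V \<Longrightarrow> ball v r2 \<inter> ball v' r2 = {}" "\<And>v'. v' \<in> V \<Longrightarrow> v \<notin> ball v' r2"
    using r1 r1pos insert.prems r1V by (auto simp: r2_def)
  have sub: "(\<Union>v\<in>V. ball v r2) \<subseteq> (\<Union>v\<in>insert v V. ball v r)" "ball v r2 \<subseteq> (\<Union>v\<in>insert v V. ball v r)"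
    using r2 by fastforce+
  \<comment> \<open>Halves of \<open>e\<close> and \<open>w\<close> allow for two summands; the
    bound 1 pays for passing from \<open>T\<close> to \<open>T + 1\<close>; the last entry ensures
    \<open>h1 v \<noteq> g v\<close>, so that the new bump has a nonzero value to take.\<close>
  define e2 where "e2 = min (e / 2) (min 1 (min (w / 2) (norm (g v) / 2)))"
  have e2: "e2 > 0" "e2 \<le> e / 2" "e2 \<le> 1" "e2 \<le> w / 2" "e2 < norm (g v)"
  proof -
    have "norm (g v) > 0" using insert.prems by auto
    then show "e2 > 0" "e2 \<le> e / 2" "e2 \<le> 1" "e2 \<le> w / 2" "e2 < norm (g v)"
      using insert.prems unfolding e2_def by linarith+
  qed
  have "\<exists>h P. finite P \<and> P \<subseteq> (\<Union>v\<in>V. ball v r2) \<and> P \<inter> V = {} \<and> (V \<noteq> {} \<longrightarrow> P \<noteq> {}) \<and>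
    h holomorphic_on - P \<and> (\<forall>p\<in>P. is_pole h p) \<and> (\<forall>v\<in>V. h v = g v) \<and> (\<forall>\<zeta>\<in>Z. h \<zeta> = 0) \<and>
    (\<forall>z. z \<notin> (\<Union>v\<in>V. ball v r2) \<longrightarrow> norm (h z) \<le> e2 \<and> norm (deriv h z) \<le> e2) \<and>
    (\<forall>z \<in> cball 0 X - (\<Union>v\<in>V. ball v r2). norm (deriv h z) \<le> e2 * norm (\<Prod>\<zeta>\<in>Z. z - \<zeta>) ^ M) \<and>
    (\<forall>z. z \<notin> P \<longrightarrow> norm (deriv h z) \<le> T + 1 \<longrightarrow> norm (h z) \<le> w / 2)"
    using insert.prems r2 e2 by (intro insert.IH) auto
  then obtain h1 P1 where h1P1: "finite P1 \<and> P1 \<subseteq> (\<Union>v\<in>V. ball v r2) \<and> P1 \<inter> V = {} \<and> (V \<noteq> {} \<longrightarrow> P1 \<noteq> {}) \<and>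
    h1 holomorphic_on - P1 \<and> (\<forall>p\<in>P1. is_pole h1 p) \<and> (\<forall>v\<in>V. h1 v = g v) \<and> (\<forall>\<zeta>\<in>Z. h1 \<zeta> = 0) \<and>
    (\<forall>z. z \<notin> (\<Union>v\<in>V. ball v r2) \<longrightarrow> norm (h1 z) \<le> e2 \<and> norm (deriv h1 z) \<le> e2) \<and>
    (\<forall>z \<in> cball 0 X - (\<Union>v\<in>V. ball v r2). norm (deriv h1 z) \<le> e2 * norm (\<Prod>\<zeta>\<in>Z. z - \<zeta>) ^ M) \<and>
    (\<forall>z. z \<notin> P1 \<longrightarrow> norm (deriv h1 z) \<le> T + 1 \<longrightarrow> norm (h1 z) \<le> w / 2)"
    by (elim exE)
  have P1: "finite P1" "P1 \<subseteq> (\<Union>v\<in>V. ball v r2)" "P1 \<inter> V = {}"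
    and h1: "h1 holomorphic_on - P1" "\<forall>p\<in>P1. is_pole h1 p" "\<forall>v\<in>V. h1 v = g v" "\<forall>\<zeta>\<in>Z. h1 \<zeta> = 0"
    using h1P1 by blast+
  have h1b: "\<And>z. z \<notin> (\<Union>v\<in>V. ball v r2) \<Longrightarrow> norm (h1 z) \<le> e2 \<and> norm (deriv h1 z) \<le> e2"
    "\<And>z. z \<in> cball 0 X - (\<Union>v\<in>V. ball v r2) \<Longrightarrow> norm (deriv h1 z) \<le> e2 * norm (\<Prod>\<zeta>\<in>Z. z - \<zeta>) ^ M"
    using h1P1 by blast+
  have h1w: "\<And>z. z \<notin> P1 \<Longrightarrow> norm (deriv h1 z) \<le> T + 1 \<Longrightarrow> norm (h1 z) \<le> w / 2"
    using h1P1 by blast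
  have vP1: "v \<notin> P1" using P1 r2 by auto
  have ne: "g v - h1 v \<noteq> 0" using h1b(1)[of v] r2 e2 by auto
  have vZ: "v \<notin> Z \<union> V" using insert.prems insert.hyps by auto
  have "bounded ((\<lambda>z. norm (\<Prod>\<zeta>\<in>V. z - \<zeta>) ^ M) ` cball 0 X)"
    by (intro compact_imp_bounded compact_continuous_image continuous_intros) auto
  then obtain C0 where "\<And>z. z \<in> cball 0 X \<Longrightarrow> norm (norm (\<Prod>\<zeta>\<in>V. z - \<zeta>) ^ M) \<le> C0"
    by (metis (no_types, lifting) bounded_iff imageI)
  then have C0: "norm (\<Prod>\<zeta>\<in>V. z - \<zeta>) ^ M \<le> max 1 C0" if "z \<in> cball 0 X" for z
    using that by fastforce
  define C where "C = max 1 C0"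
  have C: "C \<ge> 1" by (simp add: C_def)
  \<comment> \<open>The estimate for the new bump involves the product over
    \<open>Z \<union> V\<close>; on the disc the surplus factors over \<open>V\<close> cost at most
    \<open>C\<close>.\<close>
  define e3 where "e3 = e2 / C"
  have e3: "e3 > 0" "e3 \<le> e2" "e3 * C = e2" using e2 C by (auto simp: e3_def divide_le_eq)
  obtain h2 b where b: "b \<in> ball v r2" "b \<noteq> v" and h2: "h2 holomorphic_on - {b}" "is_pole h2 b" "h2 v = g v - h1 v"
    "\<And>\<zeta>. \<zeta> \<in> Z \<union> V \<Longrightarrow> h2 \<zeta> = 0"
    and h2b: "\<And>z. z \<notin> ball v r2 \<Longrightarrow> norm (h2 z) \<le> e3 \<and> norm (deriv h2 z) \<le> e3"
    "\<And>z. z \<in> cball 0 X - ball v r2 \<Longrightarrow> norm (deriv h2 z) \<le> e3 * norm (\<Prod>\<zeta>\<in>Z\<union>V. z - \<zeta>) ^ M"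
    "\<And>z. z \<noteq> b \<Longrightarrow> norm (deriv h2 z) \<le> T + 1 \<Longrightarrow> norm (h2 z) \<le> w / 2"
  proof (rule single_pole_bump[of "Z \<union> V" v "g v - h1 v" e3 r2 "T + 1" "w / 2" X M])
    show "finite (Z \<union> V)" "v \<notin> Z \<union> V" "g v - h1 v \<noteq> 0" "e3 > 0" "r2 > 0" "T + 1 > 0" "w / 2 > 0"
      using insert.hyps insert.prems ne r2 e3 vZ by simp_all
  qed (rule that; assumption)
  have bP1: "b \<notin> P1" using b P1 r2(3) by blast
  have bV: "b \<notin> V" using b r2(4)
    by (metis mem_ball dist_commute)
  define h where "h = (\<lambda>z. h1 z + h2 z)"
  have hol: "h holomorphic_on - insert b P1"
    unfolding h_def by (intro holomorphic_intros holomorphic_on_subset[OF h1(1)] holomorphic_on_subset[OF h2(1)]) auto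
  have dh: "deriv h z = deriv h1 z + deriv h2 z" if "z \<notin> insert b P1" for z
    unfolding h_def using that P1 h1 h2 by (intro deriv_add_off_poles) auto
  show ?case
  proof (intro exI[of _ h] exI[of _ "insert b P1"] conjI ballI allI impI)
    show "finite (insert b P1)" using P1 by simp
    show "insert b P1 \<subseteq> (\<Union>v\<in>insert v V. ball v r)" using b P1 sub by blast
    show "insert b P1 \<inter> insert v V = {}" using b bV P1 vP1 by auto
    show "insert b P1 \<noteq> {}" by simp
    show "h holomorphic_on - insert b P1" by (rule hol)
  next
    fix p assume p: "p \<in> insert b P1"
    show "is_pole h p"
    proof (cases "p = b")
      case True
      then show ?thesis unfolding h_def
        using bP1 P1 h1 h2 by (intro is_pole_add_analytic(2) holomorphic_analytic_at[of P1]) auto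
    next
      case False
      then show ?thesis unfolding h_def
        using p h1 h2 by (intro is_pole_add_analytic(1) holomorphic_analytic_at[of "{b}"]) auto
    qed
  next
    fix u assume "u \<in> insert v V"
    then show "h u = g u" using h1 h2 insert.hyps by (auto simp: h_def)
  next
    fix \<zeta> assume "\<zeta> \<in> Z" then show "h \<zeta> = 0" using h1 h2 by (auto simp: h_def)
  next
    fix z assume z: "z \<notin> (\<Union>v\<in>insert v V. ball v r)"
    then have z': "z \<notin> (\<Union>v\<in>V. ball v r2)" "z \<notin> ball v r2" using sub by blast+
    then have zz: "z \<notin> insert b P1" using b P1 by auto
    note bb = h1b(1)[OF z'(1)] h2b(1)[OF z'(2)]
    show "norm (h z) \<le> e" unfolding h_def
      using norm_triangle_ineq[of "h1 z" "h2 z"] bb e2 e3 by linarith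
    show "norm (deriv h z) \<le> e" unfolding dh[OF zz]
      using norm_triangle_ineq[of "deriv h1 z" "deriv h2 z"] bb e2 e3 by linarith
  next
    fix z assume z: "z \<in> cball 0 X - (\<Union>v\<in>insert v V. ball v r)"
    then have z': "z \<in> cball 0 X - (\<Union>v\<in>V. ball v r2)" "z \<in> cball 0 X - ball v r2" using sub by blast+
    then have zz: "z \<notin> insert b P1" using b P1 by auto
    define q where "q = norm (\<Prod>\<zeta>\<in>Z. z - \<zeta>) ^ M"
    have "(\<Prod>\<zeta>\<in>Z\<union>V. z - \<zeta>) = (\<Prod>\<zeta>\<in>Z. z - \<zeta>) * (\<Prod>\<zeta>\<in>V. z - \<zeta>)"
      using insert.hyps insert.prems by (intro prod.union_disjoint) auto
    then have "norm (\<Prod>\<zeta>\<in>Z\<union>V. z - \<zeta>) ^ M = q * norm (\<Prod>\<zeta>\<in>V. z - \<zeta>) ^ M"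
      by (simp add: q_def norm_mult power_mult_distrib)
    also have "\<dots> \<le> q * C"
      unfolding C_def using z C0 by (intro mult_left_mono) (auto simp: q_def)
    finally have "e3 * norm (\<Prod>\<zeta>\<in>Z\<union>V. z - \<zeta>) ^ M \<le> e3 * (q * C)"
      using e3 by (intro mult_left_mono) auto
    also have "\<dots> = e2 * q" using e3 by (metis mult.assoc mult.commute)
    finally have "norm (deriv h2 z) \<le> e2 * q" using h2b(2)[OF z'(2)] by linarith
    moreover have "norm (deriv h1 z) \<le> e2 * q" using h1b(2)[OF z'(1)] by (simp add: q_def)
    moreover have "2 * (e2 * q) \<le> e * q"
      using e2 by (simp add: q_def mult.assoc[symmetric] mult_right_mono)
    ultimately show "norm (deriv h z) \<le> e * norm (\<Prod>\<zeta>\<in>Z. z - \<zeta>) ^ M" unfolding dh[OF zz] q_def[symmetric]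
      using norm_triangle_ineq[of "deriv h1 z" "deriv h2 z"] by linarith
  next
    fix z assume z: "z \<notin> insert b P1" and T: "norm (deriv h z) \<le> T"
    note T' = T[unfolded dh[OF z]]
    show "norm (h z) \<le> w"
    \<comment> \<open>At every \<open>z\<close> at least one of \<open>h1\<close>, \<open>h2\<close>
      is in its small region, with derivative at most 1. The other then has derivative at most
      \<open>T + 1\<close>, which is the threshold used for both.\<close>
    proof (cases "z \<in> ball v r2")
      case True
      then have "z \<notin> (\<Union>v\<in>V. ball v r2)" using r2(3) by blast
      then have b1: "norm (h1 z) \<le> e2" "norm (deriv h1 z) \<le> e2" using h1b(1) by auto
      have "norm (deriv h2 z) \<le> T + 1"
        using norm_triangle_ineq4[of "deriv h1 z + deriv h2 z" "deriv h1 z"] T' b1 e2 by simp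
      then have "norm (h2 z) \<le> w / 2" using h2b(3) z by auto
      then show ?thesis unfolding h_def
        using norm_triangle_ineq[of "h1 z" "h2 z"] b1 e2 by linarith
    next
      case False
      then have b1: "norm (h2 z) \<le> e2" "norm (deriv h2 z) \<le> e2" using h2b(1)[of z] e3 by auto
      have "norm (deriv h1 z) \<le> T + 1"
        using norm_triangle_ineq4[of "deriv h1 z + deriv h2 z" "deriv h2 z"] T' b1 e2 by simp
      then have "norm (h1 z) \<le> w / 2" using h1w z by auto
      then show ?thesis unfolding h_def
        using norm_triangle_ineq[of "h1 z" "h2 z"] b1 e2 by linarith
    qed
  qed
qed

section \<open>Lower bounds near zeros and poles\<close>

text \<open>The number \<open>L\<close> serves both as exponent and as factor: within distance 1 of
  \<open>x\<close> the estimate survives any increase of \<open>L\<close>, so finitely many local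
  estimates can share one constant. The point \<open>z0\<close> excludes that \<open>g\<close>
  vanishes identically.\<close>

lemma pole_or_zero_local_bound:
  fixes g :: "complex \<Rightarrow> complex"
  assumes P: "finite P" and hol: "g holomorphic_on - P" and pole: "\<And>p. p \<in> P \<Longrightarrow> is_pole g p"
    and nz: "z0 \<notin> P" "g z0 \<noteq> 0"
  shows "\<exists>r>0. \<exists>L::nat. (\<forall>z\<in>ball x r - P. z \<noteq> x \<longrightarrow> g z \<noteq> 0) \<and>
    (\<forall>z\<in>ball x r - P. (if x \<notin> P \<and> g x = 0 then norm (z - x) ^ L else 1) \<le> L * norm (g z))"
proof -
  have op: "open (- P)" using P by (simp add: finite_imp_closed open_Compl)
  consider (pole) "x \<in> P" | (reg) "x \<notin> P" "g x \<noteq> 0" | (zero) "x \<notin> P" "g x = 0" by blast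
  then show ?thesis
  proof cases
    case pole
    then have "filterlim g at_infinity (at x)" using assms by (auto simp: is_pole_def)
    then have "eventually (\<lambda>z. norm (g z) \<ge> 1) (at x)"
      by (subst (asm) filterlim_at_infinity[of 0]) auto
    then obtain r where "r > 0" "\<And>z. z \<noteq> x \<Longrightarrow> dist z x < r \<Longrightarrow> norm (g z) \<ge> 1"
      unfolding eventually_at by auto
    then show ?thesis using pole
      by (intro exI[of _ r] conjI exI[of _ "1::nat"]) (force simp: dist_commute)+
  next
    case reg
    have "isCont g x" using hol op reg by (metis ComplI continuous_on_eq_continuous_at holomorphic_on_imp_continuous_on)
    then have "eventually (\<lambda>z. norm (g z) > norm (g x) / 2) (at x)"
      using reg by (intro order_tendstoD(1)[of _ "norm (g x)"] tendsto_norm) (auto simp: isCont_def)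
    then obtain r where r: "r > 0" "\<And>z. z \<noteq> x \<Longrightarrow> dist z x < r \<Longrightarrow> norm (g z) > norm (g x) / 2"
      unfolding eventually_at by auto
    have b: "norm (g z) \<ge> norm (g x) / 2" if "z \<in> ball x r" for z
      using r(2)[of z] that by (cases "z = x") (auto simp: dist_commute)
    obtain L :: nat where L: "real L > 2 / norm (g x)" using reals_Archimedean2 by blast
    have L1: "1 \<le> L * norm (g z)" if "z \<in> ball x r" for z
    proof -
      have "1 \<le> L * (norm (g x) / 2)" using L reg by (simp add: field_simps)
      also have "\<dots> \<le> L * norm (g z)" using b[OF that] by (intro mult_left_mono) auto
      finally show ?thesis .
    qed
    moreover have "g z \<noteq> 0" if "z \<in> ball x r" for z using L1[OF that] by auto
    ultimately show ?thesis using reg r(1) by (intro exI[of _ r] conjI exI[of _ L]) auto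
  next
    case zero
    \<comment> \<open>On a connected domain a function that is not constant vanishes only to finite
      order at \<open>x\<close>.\<close>
    have con: "connected (- P)"
      using connected_open_diff_countable[of "UNIV::complex set" P] P by (simp add: Compl_eq_Diff_UNIV countable_finite connected_UNIV)
    have "g z0 \<noteq> g x" using zero nz by simp
    then obtain k n r where k: "0 < k" "0 < r" "ball x r \<subseteq> - P"
        and b: "\<And>w. w \<in> ball x r \<Longrightarrow> k * norm (w - x) ^ n \<le> norm (g w - g x)"
      using holomorphic_lower_bound_difference[OF hol op con, of x z0] zero nz by (metis ComplI)
    obtain L0 :: nat where L0: "real L0 > 1 / k" using reals_Archimedean2 by blast
    define L where "L = max n L0"
    have L: "n \<le> L" "1 \<le> L * k"
    proof -
      have "1 < L0 * k" using L0 k by (simp add: field_simps)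
      also have "\<dots> \<le> L * k" using k by (intro mult_right_mono) (auto simp: L_def)
      finally show "1 \<le> L * k" by simp
    qed (auto simp: L_def)
    have "norm (z - x) ^ L \<le> L * norm (g z)" if "z \<in> ball x (min r 1)" for z
    proof -
      have "norm (z - x) ^ L \<le> norm (z - x) ^ n"
        using that L by (intro power_decreasing) (auto simp: dist_norm norm_minus_commute)
      also have "\<dots> \<le> (L * k) * norm (z - x) ^ n" using mult_right_mono[OF L(2), of "norm (z - x) ^ n"] by simp
      also have "\<dots> = L * (k * norm (z - x) ^ n)" by simp
      also have "\<dots> \<le> L * norm (g z)" using b[of z] that zero by (intro mult_left_mono) auto
      finally show ?thesis .
    qed
    moreover have "g z \<noteq> 0" if "z \<in> ball x (min r 1)" "z \<noteq> x" for z
    proof -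
      have "k * norm (z - x) ^ n > 0" using that k by simp
      then show ?thesis using b[of z] that zero by auto
    qed
    ultimately show ?thesis using zero k by (intro exI[of _ "min r 1"] conjI exI[of _ L]) auto
  qed
qed

text \<open>A Lojasiewicz-type inequality, obtained from the local bounds by compactness of the
  disc. With \<open>g = deriv f\<close> it converts vanishing of a correction on \<open>Z\<close> to
  high order into smallness relative to \<open>deriv f\<close>.\<close>

lemma zeros_finite_and_lower_bound:
  fixes g :: "complex \<Rightarrow> complex"
  assumes P: "finite P" and hol: "g holomorphic_on - P" and pole: "\<And>p. p \<in> P \<Longrightarrow> is_pole g p"
    and nz: "z0 \<notin> P" "g z0 \<noteq> 0"
  shows "finite {z \<in> cball 0 X - P. g z = 0}"
    and "finite Z \<Longrightarrow> {z \<in> cball 0 X - P. g z = 0} \<subseteq> Z \<Longrightarrow>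
      \<exists>M K. K > 0 \<and> M > 0 \<and> (\<forall>z\<in>cball 0 X - P. norm (\<Prod>\<zeta>\<in>Z. z - \<zeta>) ^ M \<le> K * norm (g z))"
proof -
  have "\<forall>x. \<exists>r. \<exists>L::nat. r > 0 \<and> (\<forall>z\<in>ball x r - P. z \<noteq> x \<longrightarrow> g z \<noteq> 0) \<and>
    (\<forall>z\<in>ball x r - P. (if x \<notin> P \<and> g x = 0 then norm (z - x) ^ L else 1) \<le> L * norm (g z))"
    using pole_or_zero_local_bound[OF assms] by blast
  then obtain r L where rL: "\<forall>x. r x > 0 \<and> (\<forall>z\<in>ball x (r x) - P. z \<noteq> x \<longrightarrow> g z \<noteq> 0) \<and>
    (\<forall>z\<in>ball x (r x) - P. (if x \<notin> P \<and> g x = 0 then norm (z - x) ^ L x else 1) \<le> real (L x) * norm (g z))"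
    unfolding choice_iff by (elim exE)
  have rL: "\<And>x. r x > 0" "\<And>x z. z\<in>ball x (r x) - P \<Longrightarrow> z \<noteq> x \<Longrightarrow> g z \<noteq> 0"
    "\<And>x z. z\<in>ball x (r x) - P \<Longrightarrow> (if x \<notin> P \<and> g x = 0 then norm (z - x) ^ L x else 1) \<le> L x * norm (g z)"
    using rL by blast+
  have "cball 0 X \<subseteq> (\<Union>x\<in>cball 0 X. ball x (r x))" using rL(1) by (auto intro!: bexI)
  then obtain F where F: "F \<subseteq> cball 0 X" "finite F" "cball 0 X \<subseteq> (\<Union>x\<in>F. ball x (r x))"
    using compactE_image[of "cball (0::complex) X" "cball 0 X" "\<lambda>x. ball x (r x)"] by (metis compact_cball open_ball)
  have "{z \<in> cball 0 X - P. g z = 0} \<subseteq> F"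
  proof
    fix z assume z: "z \<in> {z \<in> cball 0 X - P. g z = 0}"
    then obtain x where "x \<in> F" "z \<in> ball x (r x)" using F by blast
    then show "z \<in> F" using rL(2)[of z x] z by auto
  qed
  then show "finite {z \<in> cball 0 X - P. g z = 0}" using F finite_subset by blast
  assume Z: "finite Z" "{z \<in> cball 0 X - P. g z = 0} \<subseteq> Z"
  \<comment> \<open>Division by \<open>c \<zeta>\<close> makes every factor at most 1 on the disc.
    All factors except the one at the centre of a local bound can then be dropped, and the exponent
    can be raised to a common \<open>M\<close>.\<close>
  define c where "c = (\<lambda>\<zeta>::complex. \<bar>X\<bar> + norm \<zeta> + 1)"
  have c: "c \<zeta> \<ge> 1" for \<zeta> by (simp add: c_def)
  have c0: "c \<zeta> > 0" for \<zeta> using c[of \<zeta>] by linarith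
  have frac: "norm (z - \<zeta>) / c \<zeta> \<le> 1" "norm (z - \<zeta>) / c \<zeta> \<ge> 0" if "z \<in> cball 0 X" for z \<zeta>
  proof -
    have "norm (z - \<zeta>) \<le> norm z + norm \<zeta>" by (rule norm_triangle_ineq4)
    also have "\<dots> \<le> c \<zeta>" using that by (auto simp: c_def)
    finally show "norm (z - \<zeta>) / c \<zeta> \<le> 1" using c0[of \<zeta>] by (simp add: divide_le_eq)
    show "norm (z - \<zeta>) / c \<zeta> \<ge> 0" using c0[of \<zeta>] by simp
  qed
  define W where "W = (\<lambda>z. \<Prod>\<zeta>\<in>Z. norm (z - \<zeta>) / c \<zeta>)"
  have W01: "W z \<ge> 0" "W z \<le> 1" if "z \<in> cball 0 X" for z
    unfolding W_def using frac[OF that] by (auto intro!: prod_nonneg prod_le_1)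
  define M where "M = Max (insert 1 (L ` F))"
  have M: "L x \<le> M" if "x \<in> F" for x using that F by (auto simp: M_def)
  have M1: "M \<ge> 1" using F by (auto simp: M_def)
  have main: "W z ^ M \<le> M * norm (g z)" if z: "z \<in> cball 0 X - P" for z
  proof -
    obtain x where x: "x \<in> F" "z \<in> ball x (r x)" using F z by blast
    have "W z ^ M \<le> W z ^ L x" using W01[of z] z M[OF x(1)] by (intro power_decreasing) auto
    also have "\<dots> \<le> (if x \<notin> P \<and> g x = 0 then norm (z - x) ^ L x else 1)"
    proof (cases "x \<notin> P \<and> g x = 0")
      case True
      have "x \<in> cball 0 X" using x F by blast
      then have xZ: "x \<in> Z" using True Z by auto
      have "W z = norm (z - x) / c x * (\<Prod>\<zeta>\<in>Z - {x}. norm (z - \<zeta>) / c \<zeta>)"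
        unfolding W_def using Z xZ by (simp add: prod.remove)
      also have "\<dots> \<le> norm (z - x) / c x * 1"
        using z frac by (intro mult_left_mono prod_le_1) auto
      also have "\<dots> \<le> norm (z - x)" using c[of x] by (simp add: divide_le_eq mult_le_cancel_left1)
      finally have "W z \<le> norm (z - x)" .
      then show ?thesis using True W01 z by (auto intro!: power_mono)
    next
      case False
      then show ?thesis using W01 z by (auto intro!: power_le_one)
    qed
    also have "\<dots> \<le> L x * norm (g z)" using rL(3)[of z x] x z by auto
    also have "\<dots> \<le> M * norm (g z)" using M[OF x(1)] by (intro mult_right_mono) auto
    finally show ?thesis .
  qed
  define B where "B = (\<Prod>\<zeta>\<in>Z. c \<zeta>)"
  have B: "B > 0" using c0 by (auto simp: B_def intro!: prod_pos)
  have "norm (\<Prod>\<zeta>\<in>Z. z - \<zeta>) ^ M \<le> (M * B ^ M) * norm (g z)" if z: "z \<in> cball 0 X - P" for z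
  proof -
    have "norm (\<Prod>\<zeta>\<in>Z. z - \<zeta>) = W z * B"
      using B by (simp add: W_def B_def prod_dividef prod_norm)
    then have "norm (\<Prod>\<zeta>\<in>Z. z - \<zeta>) ^ M = W z ^ M * B ^ M" by (simp add: power_mult_distrib)
    also have "\<dots> \<le> (M * norm (g z)) * B ^ M" using main[OF z] B by (intro mult_right_mono) auto
    finally show ?thesis by (simp add: mult_ac)
  qed
  then show "\<exists>M K. K > 0 \<and> M > 0 \<and> (\<forall>z\<in>cball 0 X - P. norm (\<Prod>\<zeta>\<in>Z. z - \<zeta>) ^ M \<le> K * norm (g z))"
    using M1 B by (intro exI[of _ M] exI[of _ "M * B ^ M"]) auto
qed

section \<open>The inductive construction\<close>

text \<open>The \<open>- 1\<close> is the margin spent on errors when critical values are carried to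
  the next disc.\<close>

definition island :: "real \<Rightarrow> nat \<Rightarrow> complex set" where
  "island l k = cball (of_real (l ^ k)) (l ^ k / 8 - 1)"

lemma norm_in_island:
  assumes "l \<ge> 1" "z \<in> island l k"
  shows "norm z \<le> 9 / 8 * l ^ k - 1" "norm z \<ge> 7 / 8 * l ^ k + 1"
proof -
  have *: "norm (of_real (l ^ k) - z) \<le> l ^ k / 8 - 1" using assms by (simp add: island_def dist_norm)
  have n: "norm (of_real (l ^ k) :: complex) = l ^ k" using assms(1) by (simp del: of_real_power)
  show "norm z \<le> 9 / 8 * l ^ k - 1"
    using norm_triangle_ineq4[of "of_real (l ^ k)" "of_real (l ^ k) - z"] * n by simp
  show "norm z \<ge> 7 / 8 * l ^ k + 1"
    using norm_triangle_ineq[of "of_real (l ^ k) - z" "z"] * n by simp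
qed

lemma island_0 [simp]: "island l 0 = {}"
  by (simp add: island_def)

text \<open>The 2 is the deviation allowed for critical values and the unit ball is room for the
  next poles: \<open>l * (l ^ k / 8 - 1) + 3\<close> is at most
  \<open>l ^ Suc k / 8 - 1\<close>.\<close>

lemma island_Suc:
  assumes "l \<ge> 32" "z \<in> island l k" "norm (w - of_real l * z) \<le> 2"
  shows "ball w 1 \<subseteq> island l (Suc k)"
proof
  fix x assume x: "x \<in> ball w 1"
  have "norm (of_real (l ^ k) - z) \<le> l ^ k / 8 - 1" using assms by (simp add: island_def dist_norm)
  then have "l * norm (of_real (l ^ k) - z) \<le> l * (l ^ k / 8 - 1)" using assms by (intro mult_left_mono) auto
  moreover have "norm (of_real l * (of_real (l ^ k) - z)) = l * norm (of_real (l ^ k) - z)"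
    using assms by (simp add: norm_mult del: of_real_power)
  moreover have E: "of_real (l ^ Suc k) - x = of_real l * (of_real (l ^ k) - z) - (w - of_real l * z) + (w - x)"
    by (simp add: algebra_simps)
  have "norm (of_real (l ^ Suc k) - x) \<le> norm (of_real l * (of_real (l ^ k) - z) - (w - of_real l * z)) + norm (w - x)"
    unfolding E by (rule norm_triangle_ineq)
  moreover have "norm (of_real l * (of_real (l ^ k) - z) - (w - of_real l * z))
      \<le> norm (of_real l * (of_real (l ^ k) - z)) + norm (w - of_real l * z)"
    by (rule norm_triangle_ineq4)
  moreover have "norm (w - x) < 1" using x by (simp add: dist_norm)
  ultimately have "norm (of_real (l ^ Suc k) - x) \<le> l * (l ^ k / 8 - 1) + 2 + 1"
    using assms(3) by linarith
  also have "\<dots> \<le> l ^ Suc k / 8 - 1" using assms by (simp add: algebra_simps)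
  finally show "x \<in> island l (Suc k)" by (simp add: island_def dist_norm del: of_real_power)
qed

text \<open>
  \<open>P\<close> is the set of poles of \<open>f\<close>. The last clause says that critical points outside the \<open>n\<close>-th island
  already have their value on a super-attracting cycle; those in the \<open>n\<close>-th island are dealt with in
  the next step. Note that \<open>island l 0\<close> is empty, its radius being negative.
\<close>

definition stage :: "real \<Rightarrow> nat \<Rightarrow> (complex \<Rightarrow> complex) \<Rightarrow> complex set \<Rightarrow> bool" where
  "stage l n f P \<longleftrightarrow> finite P \<and> P \<subseteq> (\<Union>k\<le>n. island l k) \<and> f holomorphic_on - P \<and> (\<forall>p\<in>P. is_pole f p) \<and>
    (\<forall>z. z \<notin> (\<Union>k\<le>n. island l k) \<longrightarrow>
       norm (f z - of_real l * z) \<le> 1 - (1 / 2) ^ n \<and> norm (deriv f z - of_real l) \<le> 1 - (1 / 2) ^ n) \<and>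
    (\<forall>c. c \<notin> P \<longrightarrow> deriv f c = 0 \<longrightarrow> norm (f c - of_real l * c) \<le> 2) \<and>
    (\<forall>c. c \<notin> P \<longrightarrow> deriv f c = 0 \<longrightarrow> c \<notin> island l n \<longrightarrow>
       f c \<notin> P \<and> f (f c) \<notin> P \<and> deriv f (f (f c)) = 0 \<and> f (f (f c)) = f c \<and> f (f c) \<noteq> f c)"

text \<open>The steps \<open>(1 / 2) ^ Suc n\<close> add up to the error budget
  \<open>1 - (1 / 2) ^ n\<close> of \<open>stage\<close>. The lower bound on \<open>deriv f'\<close>
  takes the place of a Hurwitz argument: its factors have a positive product, so critical points
  cannot emerge in the limit. The last clause demands equalities because cycles must persist without
  error.\<close>

definition extends :: "real \<Rightarrow> nat \<Rightarrow> (complex \<Rightarrow> complex) \<Rightarrow> complex set \<Rightarrow> (complex \<Rightarrow> complex) \<Rightarrow> complex set \<Rightarrow> bool" where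
  "extends l n f P f' P' \<longleftrightarrow> P \<subset> P' \<and> P' - P \<subseteq> island l (Suc n) \<and>
    (\<lambda>z. f' z - f z) holomorphic_on - (P' - P) \<and>
    (\<forall>z. z \<notin> island l (Suc n) \<longrightarrow> norm (f' z - f z) \<le> (1 / 2) ^ Suc n) \<and>
    (\<forall>z\<in>cball 0 (2 * l ^ n) - P. norm (deriv f' z) \<ge> (1 - (1 / 2) ^ (n + 2)) * norm (deriv f z)) \<and>
    (\<forall>c. c \<notin> P \<longrightarrow> deriv f c = 0 \<longrightarrow>
       f' c = f c \<and> deriv f' c = 0 \<and> (c \<notin> island l n \<longrightarrow> f' (f c) = f (f c)))"

lemma stage_0:
  assumes "l > 0"
  shows "stage l 0 (\<lambda>z. of_real l * z) {}"
proof -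
  have [simp]: "deriv (\<lambda>z. of_real l * z) z = of_real l" for z :: complex
    by (rule DERIV_imp_deriv) (auto intro!: derivative_eq_intros)
  show ?thesis using assms by (auto simp: stage_def intro!: holomorphic_intros)
qed

lemma stage_step:
  assumes l: "l \<ge> 32" and st: "stage l n f P"
  shows "\<exists>f' P'. stage l (Suc n) f' P' \<and> extends l n f P f' P'"
proof -
  define I where "I = (\<Union>k\<le>n. island l k)"
  have P: "finite P" "P \<subseteq> I" "f holomorphic_on - P" "\<And>p. p \<in> P \<Longrightarrow> is_pole f p"
    and near: "\<And>z. z \<notin> I \<Longrightarrow> norm (f z - of_real l * z) \<le> 1 - (1 / 2) ^ n"
      "\<And>z. z \<notin> I \<Longrightarrow> norm (deriv f z - of_real l) \<le> 1 - (1 / 2) ^ n"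
    and crit: "\<And>c. c \<notin> P \<Longrightarrow> deriv f c = 0 \<Longrightarrow> norm (f c - of_real l * c) \<le> 2"
    and cyc: "\<And>c. c \<notin> P \<Longrightarrow> deriv f c = 0 \<Longrightarrow> c \<notin> island l n \<Longrightarrow>
       f c \<notin> P \<and> f (f c) \<notin> P \<and> deriv f (f (f c)) = 0 \<and> f (f (f c)) = f c \<and> f (f c) \<noteq> f c"
    using st unfolding stage_def I_def by blast+
  have op: "open (- P)" using P by (simp add: finite_imp_closed open_Compl)
  have half: "(1 / 2 :: real) ^ n > 0" by simp
  have near1: "norm (f z - of_real l * z) \<le> 1" "norm (deriv f z - of_real l) \<le> 1" if "z \<notin> I" for z
    using near[OF that] half by linarith+
  have ln: "l ^ n \<ge> 1" using l by (simp add: one_le_power)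
  have lS: "l ^ Suc n \<ge> 32 * l ^ n" using l ln by (simp add: mult_right_mono)
  \<comment> \<open>The disc of radius \<open>2 * l ^ n\<close> contains the islands up to
    \<open>n\<close>, which end before \<open>9 / 8 * l ^ n\<close>, and misses the next one, which
    starts beyond \<open>7 / 8 * l ^ Suc n\<close>.\<close>
  define X where "X = 2 * l ^ n"
  have I_X: "I \<subseteq> cball 0 X"
  proof
    fix z assume "z \<in> I"
    then obtain k where k: "k \<le> n" "z \<in> island l k" by (auto simp: I_def)
    have "l ^ k \<le> l ^ n" using k l by (intro power_increasing) auto
    moreover have "norm z \<le> 9 / 8 * l ^ k - 1" using k l by (intro norm_in_island) auto
    ultimately have "norm z \<le> 2 * l ^ n" using ln by linarith
    then show "z \<in> cball 0 X" by (simp add: X_def)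
  qed
  have S_X: "island l (Suc n) \<inter> cball 0 X = {}"
  proof -
    have "norm z > X" if "z \<in> island l (Suc n)" for z
    proof -
      have "norm z \<ge> 7 / 8 * l ^ Suc n + 1" using that l by (intro norm_in_island) auto
      then show ?thesis using lS ln unfolding X_def by linarith
    qed
    then show ?thesis by fastforce
  qed
  have S_I: "island l (Suc n) \<inter> I = {}" using S_X I_X by blast

  \<comment> \<open>Critical points of the current stage\<close>
  define C where "C = {c. c \<notin> P \<and> deriv f c = 0}"
  have C_I: "C \<subseteq> I"
  proof
    fix c assume "c \<in> C"
    then show "c \<in> I" using near(2)[of c] half l by (cases "c \<in> I") (auto simp: C_def)
  qed
  have pole': "is_pole (deriv f) p" if "p \<in> P" for p
  proof (rule is_pole_deriv)
    show "is_pole f p" using P that by blast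
    have "open (- (P - {p}))" using P by (intro open_Compl finite_imp_closed finite_Diff)
    then obtain r where "r > 0" "ball p r \<subseteq> - (P - {p})"
      by (metis Compl_iff Diff_iff open_contains_ball singletonI)
    then have "f analytic_on ball p r - {p}"
      using P(3) by (subst analytic_on_open) (auto intro: holomorphic_on_subset)
    then show "isolated_singularity_at f p" using \<open>r > 0\<close> unfolding isolated_singularity_at_def by blast
  qed
  have hol': "deriv f holomorphic_on - P" using P op by (intro holomorphic_deriv) auto
  \<comment> \<open>A point off all islands, where \<open>deriv f\<close> is within 1 of
    \<open>l\<close>, shows that \<open>deriv f\<close> is not identically zero.\<close>
  have "of_real (- X - 1) \<notin> I"
    using I_X by (force simp del: of_real_diff of_real_minus)
  then have nz: "of_real (- X - 1) \<notin> P" "deriv f (of_real (- X - 1)) \<noteq> 0"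
    using P(2) C_I by (auto simp: C_def simp del: of_real_diff of_real_minus)
  have "C = {z \<in> cball 0 X - P. deriv f z = 0}" using C_I I_X by (auto simp: C_def)
  then have finC: "finite C"
    using zeros_finite_and_lower_bound(1)[OF P(1) hol' pole' nz] by simp

  \<comment> \<open>Prescribed values and prescribed zeros of the correction\<close>
  define V0 where "V0 = f ` (C \<inter> island l n)"
  have V0: "ball v 1 \<subseteq> island l (Suc n)" if "v \<in> V0" for v
  proof -
    obtain c where "c \<in> C" "c \<in> island l n" "v = f c" using \<open>v \<in> V0\<close> by (auto simp: V0_def)
    then show ?thesis using island_Suc[OF l, of c n v] crit[of c] by (simp add: C_def)
  qed
  \<comment> \<open>The extra point \<open>x\<close> forces a new pole at every step, which makes the limit transcendental.\<close>
  have "infinite (ball (of_real (l ^ Suc n) :: complex) 1)" by (metis countable_finite uncountable_ball zero_less_one)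
  then obtain x where x: "x \<in> ball (of_real (l ^ Suc n)) 1" "x \<notin> V0"
    using finC unfolding V0_def by (meson finite_Int finite_imageI finite_subset subsetI)
  have xS: "ball x 1 \<subseteq> island l (Suc n)"
  proof -
    have "(1::real) + 1 \<le> l ^ Suc n / 8 - 1" using lS ln by linarith
    then show ?thesis using x(1) unfolding island_def
      by (intro subset_trans[OF ball_subset_cball] cball_subset_cball_iff[THEN iffD2]) (auto simp: dist_commute)
  qed
  define V where "V = insert x V0"
  have V: "finite V" "V \<noteq> {}" "\<And>v. v \<in> V \<Longrightarrow> ball v 1 \<subseteq> island l (Suc n)"
    using finC V0 xS by (auto simp: V_def V0_def)
  have VS: "v \<in> island l (Suc n)" if "v \<in> V" for v using V(3)[OF that] by auto
  \<comment> \<open>Several critical points may share the value \<open>v\<close>; one choice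
    suffices, since the cycle of \<open>v\<close> only has to pass through some critical point with
    value \<open>v\<close>.\<close>
  have "\<forall>v\<in>V0. \<exists>c. c \<in> C \<inter> island l n \<and> f c = v" by (auto simp: V0_def)
  then obtain pre where pre: "\<And>v. v \<in> V0 \<Longrightarrow> pre v \<in> C \<inter> island l n \<and> f (pre v) = v" by metis
  \<comment> \<open>At the extra point the target 0 is arbitrary. The prescribed value is never
    zero: \<open>f v\<close> is within 1 of \<open>l * v\<close>, far outside the disc of radius
    \<open>X\<close> that contains every target.\<close>
  define g where "g = (\<lambda>v. (if v \<in> V0 then pre v else 0) - f v)"
  have g: "g v \<noteq> 0" if "v \<in> V" for v
  proof
    assume "g v = 0"
    then have *: "norm (f v) = norm (if v \<in> V0 then pre v else 0)" by (simp add: g_def)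
    have "v \<notin> I" using VS[OF that] S_I by blast
    then have "norm (f v - of_real l * v) \<le> 1" using near(1)[of v] half by linarith
    then have "norm (of_real l * v) \<le> norm (f v) + 1"
      using norm_triangle_ineq4[of "f v" "f v - of_real l * v"] by simp
    moreover have "norm (of_real l * v) = l * norm v" using l by (simp add: norm_mult)
    moreover have "l * norm v \<ge> 1 * norm v" using l by (intro mult_right_mono) auto
    moreover have "norm v > X + 1"
    proof -
      have "norm v \<ge> 7 / 8 * l ^ Suc n + 1" using VS[OF that] l by (intro norm_in_island) auto
      then show ?thesis using lS ln unfolding X_def by linarith
    qed
    moreover have "norm (if v \<in> V0 then pre v else 0) \<le> X"
    proof (cases "v \<in> V0")
      case True
      then have "pre v \<in> cball 0 X" using pre[of v] C_I I_X by blast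
      then show ?thesis using True by simp
    qed (use ln in \<open>simp add: X_def\<close>)
    ultimately show False using * by linarith
  qed
  \<comment> \<open>Zeros on \<open>C\<close> preserve the critical values; zeros at the values of
    the critical points already settled preserve the second half of their cycles. Those values lie
    in islands of index at most \<open>n\<close>, hence away from \<open>V\<close>.\<close>
  define Z where "Z = C \<union> f ` (C - island l n)"
  have ZI: "Z \<subseteq> I"
  proof -
    have "f c \<in> I" if "c \<in> C" "c \<notin> island l n" for c
    proof -
      have "c \<in> I" using that C_I by blast
      then obtain k where k: "k \<le> n" "c \<in> island l k" by (auto simp: I_def)
      then have "Suc k \<le> n" using that by (metis le_antisym not_less_eq_eq)
      moreover have "f c \<in> island l (Suc k)"
        using island_Suc[OF l k(2) crit[of c]] that by (force simp: C_def)
      ultimately show ?thesis by (auto simp: I_def)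
    qed
    then show ?thesis using C_I by (auto simp: Z_def)
  qed
  have finZ: "finite Z" using finC by (simp add: Z_def)
  have VZ: "V \<inter> Z = {}" using VS ZI S_I by blast
  have "{z \<in> cball 0 X - P. deriv f z = 0} \<subseteq> Z" by (auto simp: Z_def C_def)
  with zeros_finite_and_lower_bound(2)[OF P(1) hol' pole' nz finZ, of X]
  have "\<exists>M K. K > 0 \<and> M > 0 \<and> (\<forall>z\<in>cball 0 X - P. norm (\<Prod>\<zeta>\<in>Z. z - \<zeta>) ^ M \<le> K * norm (deriv f z))"
    by blast
  then
  obtain M K where MK0: "K > 0 \<and> M > 0 \<and> (\<forall>z\<in>cball 0 X - P. norm (\<Prod>\<zeta>\<in>Z. z - \<zeta>) ^ M \<le> K * norm (deriv f z))"
    by (elim exE)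
  then have MK: "K > 0" "M > 0"
    "\<And>z. z \<in> cball 0 X - P \<Longrightarrow> norm (\<Prod>\<zeta>\<in>Z. z - \<zeta>) ^ M \<le> K * norm (deriv f z)"
    by blast+
  \<comment> \<open>The first entry is the error budget of this step; the second combines with
    \<open>K\<close> to \<open>|h'| \<le> (1 / 2) ^ (n + 2) * |f'|\<close> on the disc.\<close>
  define e where "e = min ((1 / 2) ^ Suc n) ((1 / 2) ^ (n + 2) / K)"
  have e: "e > 0" "e \<le> (1 / 2) ^ Suc n" "e * K \<le> (1 / 2) ^ (n + 2)"
  proof -
    show "e > 0" using MK by (simp add: e_def)
    show "e \<le> (1 / 2) ^ Suc n" unfolding e_def by (rule min.cobounded1)
    have "e \<le> (1 / 2) ^ (n + 2) / K" unfolding e_def by (rule min.cobounded2)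
    then show "e * K \<le> (1 / 2) ^ (n + 2)" using MK by (simp only: pos_le_divide_eq)
  qed
  define U where "U = (\<Union>v\<in>V. ball v 1)"
  have US: "U \<subseteq> island l (Suc n)" using V by (auto simp: U_def)
  \<comment> \<open>A critical point of \<open>f + h\<close> outside \<open>I\<close> has
    \<open>|h'| = |f'| \<le> l + 1\<close>. The last clause then gives \<open>|h| \<le> 1\<close>
    there, so the new critical value is within 2 of \<open>l * c\<close>.\<close>
  have "\<exists>h Q. finite Q \<and> Q \<subseteq> U \<and> Q \<inter> V = {} \<and> (V \<noteq> {} \<longrightarrow> Q \<noteq> {}) \<and>
    h holomorphic_on - Q \<and> (\<forall>p\<in>Q. is_pole h p) \<and> (\<forall>v\<in>V. h v = g v) \<and> (\<forall>\<zeta>\<in>Z. h \<zeta> = 0) \<and>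
    (\<forall>z. z \<notin> U \<longrightarrow> norm (h z) \<le> e \<and> norm (deriv h z) \<le> e) \<and>
    (\<forall>z \<in> cball 0 X - U. norm (deriv h z) \<le> e * norm (\<Prod>\<zeta>\<in>Z. z - \<zeta>) ^ M) \<and>
    (\<forall>z. z \<notin> Q \<longrightarrow> norm (deriv h z) \<le> l + 1 \<longrightarrow> norm (h z) \<le> 1)"
    unfolding U_def using V finZ VZ g e l by (intro poles_bump) auto
  then obtain h Q where hQ: "finite Q \<and> Q \<subseteq> U \<and> Q \<inter> V = {} \<and> (V \<noteq> {} \<longrightarrow> Q \<noteq> {}) \<and>
    h holomorphic_on - Q \<and> (\<forall>p\<in>Q. is_pole h p) \<and> (\<forall>v\<in>V. h v = g v) \<and> (\<forall>\<zeta>\<in>Z. h \<zeta> = 0) \<and>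
    (\<forall>z. z \<notin> U \<longrightarrow> norm (h z) \<le> e \<and> norm (deriv h z) \<le> e) \<and>
    (\<forall>z \<in> cball 0 X - U. norm (deriv h z) \<le> e * norm (\<Prod>\<zeta>\<in>Z. z - \<zeta>) ^ M) \<and>
    (\<forall>z. z \<notin> Q \<longrightarrow> norm (deriv h z) \<le> l + 1 \<longrightarrow> norm (h z) \<le> 1)" by (elim exE)
  have Q: "finite Q" "Q \<subseteq> U" "Q \<inter> V = {}" "Q \<noteq> {}" "h holomorphic_on - Q" "\<And>p. p \<in> Q \<Longrightarrow> is_pole h p"
    and hV: "\<And>v. v \<in> V \<Longrightarrow> h v = g v" and hZ: "\<And>\<zeta>. \<zeta> \<in> Z \<Longrightarrow> h \<zeta> = 0"
    and hU: "\<And>z. z \<notin> U \<Longrightarrow> norm (h z) \<le> e" "\<And>z. z \<notin> U \<Longrightarrow> norm (deriv h z) \<le> e"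
    and hX: "\<And>z. z \<in> cball 0 X - U \<Longrightarrow> norm (deriv h z) \<le> e * norm (\<Prod>\<zeta>\<in>Z. z - \<zeta>) ^ M"
    and h1: "\<And>z. z \<notin> Q \<Longrightarrow> norm (deriv h z) \<le> l + 1 \<Longrightarrow> norm (h z) \<le> 1"
    using hQ V(2) by blast+
  have QS: "Q \<subseteq> island l (Suc n)" using Q US by blast
  have QI: "Q \<inter> I = {}" using QS S_I by blast
  have PQ: "P \<inter> Q = {}" using P(2) QI by blast
  define f' where "f' = (\<lambda>z. f z + h z)"
  define P' where "P' = P \<union> Q"
  have df': "deriv f' z = deriv f z + deriv h z" if "z \<notin> P'" for z
    unfolding f'_def using that P Q by (intro deriv_add_off_poles[of P _ Q]) (auto simp: P'_def)
  have small: "norm (deriv h z) \<le> (1 / 2) ^ (n + 2) * norm (deriv f z)" if "z \<in> cball 0 X - P" for z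
  proof -
    have "norm (deriv h z) \<le> e * norm (\<Prod>\<zeta>\<in>Z. z - \<zeta>) ^ M" using hX[of z] that US S_X by blast
    also have "\<dots> \<le> e * (K * norm (deriv f z))" using MK(3)[OF that] e by (intro mult_left_mono) auto
    also have "\<dots> = (e * K) * norm (deriv f z)" by simp
    also have "\<dots> \<le> (1 / 2) ^ (n + 2) * norm (deriv f z)" using e by (intro mult_right_mono) auto
    finally show ?thesis .
  qed
  have XP': "z \<notin> P'" if "z \<in> cball 0 X - P" for z using that QS S_X by (auto simp: P'_def)
  have lower: "norm (deriv f' z) \<ge> (1 - (1 / 2) ^ (n + 2)) * norm (deriv f z)" if z: "z \<in> cball 0 X - P" for z
  proof -
    have "norm (deriv f z) \<le> norm (deriv f' z) + norm (deriv h z)"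
      using norm_triangle_ineq4[of "deriv f' z" "deriv h z"] by (simp add: df'[OF XP'[OF z]])
    then show ?thesis using small[OF z] by (simp add: left_diff_distrib)
  qed
  have C': "f' c = f c" "deriv f' c = 0" "c \<notin> P'" if "c \<in> C" for c
  proof -
    have c: "c \<in> cball 0 X - P" using that C_I I_X by (auto simp: C_def)
    show "c \<notin> P'" by (rule XP'[OF c])
    then show "deriv f' c = 0" using df' small[OF c] that by (simp add: C_def)
    show "f' c = f c" using hZ that by (simp add: f'_def Z_def)
  qed
  have half2: "(1 / 2 :: real) ^ (n + 2) < 1" using power_Suc_less_one[of "1 / 2 :: real" "Suc n"] by simp
  have C'': "c \<in> C" if "c \<notin> P'" "deriv f' c = 0" "c \<in> I" for c
  proof -
    have c: "c \<in> cball 0 X - P" using that I_X by (auto simp: P'_def)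
    have "(1 - (1 / 2) ^ (n + 2)) * norm (deriv f c) \<le> 0" using lower[OF c] that by simp
    then have "deriv f c = 0" using half2 by (simp add: mult_le_0_iff)
    then show ?thesis using c by (simp add: C_def)
  qed
  have critI: "c \<in> I \<union> island l (Suc n)" if "c \<notin> P'" "deriv f' c = 0" for c
  proof (rule ccontr)
    assume "c \<notin> I \<union> island l (Suc n)"
    then have c: "c \<notin> I" "c \<notin> U" using US by auto
    have "norm (deriv f c - of_real l) + norm (deriv h c) \<le> 1"
      using near(2)[OF c(1)] hU(2)[OF c(2)] e half by simp
    moreover have "norm (of_real l :: complex) = norm ((deriv f c - of_real l) + deriv h c)"
      using that df' norm_minus_cancel[of "of_real l :: complex"] by (metis add.commute add_diff_eq diff_0)
    ultimately show False using norm_triangle_ineq[of "deriv f c - of_real l" "deriv h c"] l by simp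
  qed

  \<comment> \<open>Verification of the next stage\<close>
  have "stage l (Suc n) f' P'"
    unfolding stage_def
  proof (intro conjI allI impI ballI)
    have Un: "(\<Union>k\<le>Suc n. island l k) = I \<union> island l (Suc n)" by (simp add: I_def atMost_Suc Un_commute)
    show "finite P'" using P Q by (simp add: P'_def)
    show "P' \<subseteq> (\<Union>k\<le>Suc n. island l k)" unfolding Un using P QS by (auto simp: P'_def)
    show "f' holomorphic_on - P'" unfolding f'_def P'_def
      by (intro holomorphic_intros holomorphic_on_subset[OF P(3)] holomorphic_on_subset[OF Q(5)]) auto
    show "is_pole f' p" if "p \<in> P'" for p
    proof (cases "p \<in> P")
      case True
      then show ?thesis unfolding f'_def using P Q PQ
        by (intro is_pole_add_analytic(1) holomorphic_analytic_at[of Q]) auto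
    next
      case False
      then show ?thesis unfolding f'_def using P Q PQ that
        by (intro is_pole_add_analytic(2) holomorphic_analytic_at[of P]) (auto simp: P'_def)
    qed
    fix c
    show "norm (f' c - of_real l * c) \<le> 1 - (1 / 2) ^ Suc n" if "c \<notin> (\<Union>k\<le>Suc n. island l k)"
    proof -
      have c: "c \<notin> I" "c \<notin> U" using that US unfolding Un by auto
      show ?thesis
        using near(1)[OF c(1)] hU(1)[OF c(2)] e norm_triangle_ineq[of "f c - of_real l * c" "h c"]
        by (simp add: f'_def algebra_simps)
    qed
    show "norm (deriv f' c - of_real l) \<le> 1 - (1 / 2) ^ Suc n" if "c \<notin> (\<Union>k\<le>Suc n. island l k)"
    proof -
      have c: "c \<notin> I" "c \<notin> U" using that US unfolding Un by auto
      have "c \<notin> P'" using c P Q by (auto simp: P'_def)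
      then show ?thesis
        using near(2)[OF c(1)] hU(2)[OF c(2)] e norm_triangle_ineq[of "deriv f c - of_real l" "deriv h c"]
        by (simp add: df' algebra_simps)
    qed
    assume c: "c \<notin> P'" "deriv f' c = 0"
    show "norm (f' c - of_real l * c) \<le> 2"
    proof (cases "c \<in> I")
      case True
      then show ?thesis using C''[OF c] C' crit[of c] by (auto simp: C_def)
    next
      case False
      have "deriv h c = - deriv f c" using df'[OF c(1)] c(2) by (simp add: eq_neg_iff_add_eq_0 add.commute)
      then have "norm (deriv h c) = norm (deriv f c)" by simp
      also have "\<dots> \<le> l + 1"
        using near1(2)[OF False] l norm_triangle_ineq[of "deriv f c - of_real l" "of_real l"] by simp
      finally have "norm (h c) \<le> 1" using h1 c by (auto simp: P'_def)
      then show ?thesis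
        using near1(1)[OF False] norm_triangle_ineq[of "f c - of_real l * c" "h c"]
        by (simp add: f'_def algebra_simps)
    qed
    assume cS: "c \<notin> island l (Suc n)"
    then have cC: "c \<in> C" using critI[OF c] C''[OF c] by blast
    \<comment> \<open>Membership in \<open>C\<close> suffices, because \<open>f'\<close> agrees with
      \<open>f\<close> on \<open>C\<close> and is critical there. For \<open>c\<close> in the
      \<open>n\<close>-th island the cycle is created now; otherwise it is inherited.\<close>
    have "f' c \<notin> P' \<and> f' (f' c) \<in> C \<and> f (f' (f' c)) = f' c \<and> f' (f' c) \<noteq> f' c"
    proof (cases "c \<in> island l n")
      case True
      define v where "v = f c"
      have v: "v \<in> V0" "v \<in> V" using True cC by (auto simp: V0_def V_def v_def)
      then have fv: "f' v = pre v" using hV[of v] by (simp add: f'_def g_def)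
      have "v \<notin> P'" using VS[OF v(2)] P(2) S_I Q v by (auto simp: P'_def)
      moreover have "pre v \<in> C" "f (pre v) = v" using pre[OF v(1)] by auto
      moreover have "pre v \<noteq> v" using \<open>pre v \<in> C\<close> C_I S_I VS[OF v(2)] by auto
      ultimately show ?thesis using C'(1)[OF cC] fv by (simp add: v_def)
    next
      case False
      then have cy: "f c \<notin> P" "f (f c) \<in> C" "f (f (f c)) = f c" "f (f c) \<noteq> f c"
        using cyc[of c] cC by (auto simp: C_def)
      have "f c \<in> Z" using False cC by (auto simp: Z_def)
      then have "h (f c) = 0" "f c \<notin> Q" using hZ ZI QI by auto
      then show ?thesis using cy C'(1)[OF cC] by (simp add: f'_def P'_def)
    qed
    then show "f' c \<notin> P'" "f' (f' c) \<notin> P'" "deriv f' (f' (f' c)) = 0" "f' (f' (f' c)) = f' c" "f' (f' c) \<noteq> f' c"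
      using C' by auto
  qed
  moreover have "extends l n f P f' P'"
    unfolding extends_def
  proof (intro conjI allI impI ballI)
    show "P \<subset> P'" using Q PQ by (auto simp: P'_def)
    have eq: "P' - P = Q" using PQ by (auto simp: P'_def)
    show "P' - P \<subseteq> island l (Suc n)" unfolding eq by (rule QS)
    show "(\<lambda>z. f' z - f z) holomorphic_on - (P' - P)" unfolding eq f'_def using Q by simp
    show "norm (f' z - f z) \<le> (1 / 2) ^ Suc n" if "z \<notin> island l (Suc n)" for z
    proof -
      have "norm (h z) \<le> e" using hU(1) that US by blast
      then show ?thesis using e(2) by (simp only: f'_def add_diff_cancel_left')
    qed
    show "(1 - (1 / 2) ^ (n + 2)) * norm (deriv f z) \<le> norm (deriv f' z)" if "z \<in> cball 0 (2 * l ^ n) - P" for z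
      using lower that by (simp add: X_def)
    fix c assume c: "c \<notin> P" "deriv f c = 0"
    then have cC: "c \<in> C" by (simp add: C_def)
    then show "f' c = f c" "deriv f' c = 0" using C' by auto
    assume "c \<notin> island l n"
    then show "f' (f c) = f (f c)" using cC hZ by (auto simp: f'_def Z_def)
  qed
  ultimately show ?thesis by blast
qed

section \<open>The limit function\<close>

lemma limit_function:
  assumes l: "l \<ge> 32"
  obtains F :: "complex \<Rightarrow> complex" and P :: "complex set" where
    "infinite P" "P \<subseteq> (\<Union>k. island l k)"
    "\<And>p. p \<in> P \<Longrightarrow> is_pole F p" "\<And>p. p \<in> P \<Longrightarrow> F p = 0"
    "\<And>z. z \<notin> P \<Longrightarrow> F analytic_on {z}"
    "\<And>z. z \<notin> (\<Union>k. island l k) \<Longrightarrow> norm (F z - of_real l * z) \<le> 1"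
    "\<And>c. c \<notin> P \<Longrightarrow> deriv F c = 0 \<Longrightarrow> F c \<notin> P \<and> F (F c) \<notin> P \<and> F (F (F c)) = F c \<and>
       deriv F (F (F c)) = 0 \<and> F (F c) \<noteq> F c"
proof -
  have "\<exists>s. \<forall>n. stage l n (fst (s n)) (snd (s n)) \<and>
      extends l n (fst (s n)) (snd (s n)) (fst (s (Suc n))) (snd (s (Suc n)))"
  proof (rule dependent_nat_choice)
    show "\<exists>x. stage l 0 (fst x) (snd x)"
      using stage_0[of l] l by (intro exI[of _ "(\<lambda>z. of_real l * z, {})"]) auto
    show "\<exists>y. stage l (Suc n) (fst y) (snd y) \<and> extends l n (fst x) (snd x) (fst y) (snd y)"
      if "stage l n (fst x) (snd x)" for x n
      using stage_step[OF l that] by auto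
  qed
  then obtain s where s: "\<And>n. stage l n (fst (s n)) (snd (s n))"
    "\<And>n. extends l n (fst (s n)) (snd (s n)) (fst (s (Suc n))) (snd (s (Suc n)))" by blast
  define f where "f n = fst (s n)" for n
  define P where "P n = snd (s n)" for n
  have stage: "stage l n (f n) (P n)" and ext: "extends l n (f n) (P n) (f (Suc n)) (P (Suc n))" for n
    using s by (auto simp: f_def P_def)
  note st = stage[unfolded stage_def] and ex = ext[unfolded extends_def]
  have finP: "finite (P n)" and holf: "f n holomorphic_on - P n"
    and polef: "\<And>p. p \<in> P n \<Longrightarrow> is_pole (f n) p" and Pisl: "P n \<subseteq> (\<Union>k\<le>n. island l k)" for n
    using st[of n] by blast+
  have closer: "z \<notin> (\<Union>k\<le>n. island l k) \<Longrightarrow> norm (f n z - of_real l * z) \<le> 1 - (1 / 2) ^ n" for z n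
    using st[of n] by blast
  have cyc: "c \<notin> P n \<Longrightarrow> deriv (f n) c = 0 \<Longrightarrow> c \<notin> island l n \<Longrightarrow>
       f n c \<notin> P n \<and> f n (f n c) \<notin> P n \<and> deriv (f n) (f n (f n c)) = 0 \<and> f n (f n (f n c)) = f n c \<and> f n (f n c) \<noteq> f n c" for c n
    using st[of n] by blast
  have Pss: "P n \<subset> P (Suc n)" and PSuc: "P (Suc n) - P n \<subseteq> island l (Suc n)"
    and holdiff: "(\<lambda>z. f (Suc n) z - f n z) holomorphic_on - (P (Suc n) - P n)" for n
    using ex[of n] by blast+
  have step: "z \<notin> island l (Suc n) \<Longrightarrow> norm (f (Suc n) z - f n z) \<le> (1 / 2) ^ Suc n" for z n
    using ex[of n] by blast
  have lower: "z \<in> cball 0 (2 * l ^ n) - P n \<Longrightarrow> norm (deriv (f (Suc n)) z) \<ge> (1 - (1 / 2) ^ (n + 2)) * norm (deriv (f n) z)" for z n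
    using ex[of n] by blast
  have keep: "c \<notin> P n \<Longrightarrow> deriv (f n) c = 0 \<Longrightarrow>
       f (Suc n) c = f n c \<and> deriv (f (Suc n)) c = 0 \<and> (c \<notin> island l n \<longrightarrow> f (Suc n) (f n c) = f n (f n c))" for c n
    using ex[of n] by blast

  \<comment> \<open>Poles inside a fixed disc\<close>
  have Pmono: "P m \<subseteq> P n" if "m \<le> n" for m n
    by (rule lift_Suc_mono_le[of P, OF psubset_imp_subset[OF Pss] that])
  define P\<omega> where "P\<omega> = (\<Union>n. P n)"
  \<comment> \<open>These discs exhaust the plane, and \<open>B N\<close> meets no island of index
    above \<open>N\<close>; from stage \<open>N\<close> on, only holomorphic corrections are added
    on it.\<close>
  define B where "B N = ball (0::complex) (2 * l ^ N)" for N
  have B_isl: "B N \<inter> island l (Suc k) = {}" if "N \<le> k" for N k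
  proof -
    have "z \<notin> B N" if z: "z \<in> island l (Suc k)" for z
    proof -
      have "l ^ N \<ge> 1" using l by (simp add: one_le_power)
      moreover have "l ^ N \<le> l ^ k" using \<open>N \<le> k\<close> l by (intro power_increasing) auto
      moreover have "l ^ Suc k \<ge> 32 * l ^ k" using l by (simp add: mult_right_mono)
      moreover have "norm z \<ge> 7 / 8 * l ^ Suc k + 1" using z l by (intro norm_in_island) auto
      ultimately have "norm z > 2 * l ^ N" by linarith
      then show ?thesis by (simp add: B_def)
    qed
    then show ?thesis by blast
  qed
  have ex_B: "\<exists>N. z \<in> B N" for z
  proof -
    obtain N where "norm z < l ^ N" using real_arch_pow[of l "norm z"] l by auto
    moreover have "l ^ N \<ge> 0" using l by simp
    ultimately have "norm z < 2 * l ^ N" by linarith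
    then show ?thesis by (auto simp: B_def)
  qed
  have PB: "z \<in> P N" if "z \<in> P n" "z \<in> B N" for z n N
  proof (cases "n \<le> N")
    case False
    then have "N \<le> n" by simp
    then show ?thesis using that(1)
    proof (induction rule: dec_induct)
      case (step m)
      then have "z \<in> P m" using PSuc[of m] B_isl[of N m] that(2) by blast
      then show ?case using step by blast
    qed
  qed (use that Pmono in blast)
  have P\<omega>B: "P\<omega> \<inter> B N = P N \<inter> B N" for N using PB by (auto simp: P\<omega>_def)

  \<comment> \<open>Convergence and regularity of the limit\<close>
  have tele: "norm (f (n + j) z - f n z) \<le> (1 / 2) ^ n - (1 / 2) ^ (n + j)" if "z \<in> B N" "N \<le> n" for z N n j
  proof (induction j)
    case (Suc j)
    have "norm (f (Suc (n + j)) z - f (n + j) z) \<le> (1 / 2) ^ Suc (n + j)"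
      using that B_isl[of N "n + j"] by (intro step) auto
    moreover have "norm (f (n + Suc j) z - f n z) \<le> norm (f (Suc (n + j)) z - f (n + j) z) + norm (f (n + j) z - f n z)"
      using norm_triangle_ineq[of "f (Suc (n + j)) z - f (n + j) z" "f (n + j) z - f n z"] by simp
    ultimately show ?case using Suc.IH by simp
  qed simp
  have tele': "norm (f m z - f n z) \<le> (1 / 2) ^ n" if "z \<in> B N" "N \<le> n" "n \<le> m" for z N n m
  proof -
    have "norm (f (n + (m - n)) z - f n z) \<le> (1 / 2) ^ n - (1 / 2) ^ (n + (m - n))"
      by (rule tele[OF that(1,2)])
    then show ?thesis using that(3) zero_le_power[of "1/2::real" m] by (simp del: zero_le_power)
  qed
  \<comment> \<open>The pointwise limit exists at poles as well: \<open>extends\<close> bounds the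
    change at every point off the new island, including the formal values at old poles. This allows
    uniform limits on all of \<open>B N\<close>.\<close>
  define G where "G z = lim (\<lambda>n. f n z)" for z
  have lim: "(\<lambda>n. f n z) \<longlonglongrightarrow> G z" for z
  proof -
    obtain N where N: "z \<in> B N" using ex_B by blast
    have "Cauchy (\<lambda>n. f n z)"
    proof (rule metric_CauchyI)
      fix e :: real assume "e > 0"
      then obtain M0 where M0: "(1 / 2) ^ M0 < e / 2" using real_arch_pow_inv[of "e / 2" "1 / 2"] by auto
      define M where "M = max M0 N"
      have "(1 / 2 :: real) ^ M \<le> (1 / 2) ^ M0" by (intro power_decreasing) (auto simp: M_def)
      then have M: "(1 / 2) ^ M < e / 2" using M0 by linarith
      have "dist (f m z) (f n z) < e" if "m \<ge> M" "n \<ge> M" for m n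
      proof -
        have "dist (f m z) (f M z) \<le> (1 / 2) ^ M" "dist (f n z) (f M z) \<le> (1 / 2) ^ M"
          using tele'[OF N, of M] that by (auto simp: dist_norm M_def)
        then show ?thesis using M dist_triangle2[of "f m z" "f n z" "f M z"] by linarith
      qed
      then show "\<exists>M. \<forall>m\<ge>M. \<forall>n\<ge>M. dist (f m z) (f n z) < e" by blast
    qed
    then show ?thesis unfolding G_def by (simp add: Cauchy_convergent convergent_LIMSEQ_iff[symmetric])
  qed
  have limG: "norm (G z - f n z) \<le> (1 / 2) ^ n" if "z \<in> B N" "N \<le> n" for z N n
  proof (rule tendsto_upperbound)
    show "(\<lambda>m. norm (f m z - f n z)) \<longlonglongrightarrow> norm (G z - f n z)" by (intro tendsto_intros lim)
    show "\<forall>\<^sub>F m in sequentially. norm (f m z - f n z) \<le> (1 / 2) ^ n"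
      using eventually_ge_at_top[of n] by eventually_elim (use tele' that in blast)
  qed simp
  have ulim: "uniform_limit (B N) (\<lambda>n. f (n + N)) G sequentially" for N
  proof (rule uniform_limitI)
    fix e :: real assume "e > 0"
    then have "\<forall>\<^sub>F n in sequentially. (1 / 2) ^ (n + N) < e"
      using order_tendstoD(2)[OF LIMSEQ_ignore_initial_segment[OF LIMSEQ_power_zero[of "1 / 2 :: real"]], of e N] by simp
    then show "\<forall>\<^sub>F n in sequentially. \<forall>z\<in>B N. dist (f (n + N) z) (G z) < e"
    proof eventually_elim
      case (elim n)
      then show ?case using limG[of _ N "n + N"] by (fastforce simp: dist_norm norm_minus_commute)
    qed
  qed
  have openB: "open (B N)" for N by (simp add: B_def)
  have openBP: "open (B N - P N)" for N using finP openB by (simp add: open_Diff finite_imp_closed)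
  have holN: "(\<lambda>z. f (n + N) z - f N z) holomorphic_on B N" for n N
  proof (induction n)
    case (Suc n)
    have "(\<lambda>z. f (Suc (n + N)) z - f (n + N) z) holomorphic_on B N"
      by (rule holomorphic_on_subset[OF holdiff]) (use PSuc[of "n + N"] B_isl[of N "n + N"] in auto)
    from holomorphic_on_add[OF this Suc.IH] show ?case by simp
  qed simp
  have holH: "(\<lambda>z. G z - f N z) holomorphic_on B N" for N
  proof (rule holomorphic_uniform_sequence[OF openB holN])
    fix x assume "x \<in> B N"
    then obtain d where d: "d > 0" "cball x d \<subseteq> B N" using openB open_contains_cball by blast
    have "uniform_limit (B N) (\<lambda>n z. f (n + N) z - f N z) (\<lambda>z. G z - f N z) sequentially"
      by (intro uniform_limit_minus ulim uniform_limit_const)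
    then show "\<exists>d>0. cball x d \<subseteq> B N \<and> uniform_limit (cball x d) (\<lambda>n z. f (n + N) z - f N z) (\<lambda>z. G z - f N z) sequentially"
      using d uniform_limit_on_subset by blast
  qed
  \<comment> \<open>The value 0 at poles is the convention of
    \<open>nicely_meromorphic_on\<close>.\<close>
  define F where "F z = (if z \<in> P\<omega> then 0 else G z)" for z
  have FG: "F z = G z" if "z \<in> B N - P N" for z N
    using that P\<omega>B by (auto simp: F_def)
  have holG: "G holomorphic_on B N - P N" for N
  proof -
    have "(\<lambda>z. (G z - f N z) + f N z) holomorphic_on B N - P N"
      by (intro holomorphic_on_add holomorphic_on_subset[OF holH[of N]] holomorphic_on_subset[OF holf[of N]]) auto
    then show ?thesis by simp
  qed
  have holF: "F holomorphic_on B N - P N" for N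
    using holG[of N] FG by (subst holomorphic_cong[OF refl]) auto
  have ulimF: "uniform_limit (B N - P N) (\<lambda>n. f (n + N)) F sequentially" for N
  proof -
    have "uniform_limit (B N - P N) (\<lambda>n. f (n + N)) G sequentially"
      using ulim by (rule uniform_limit_on_subset) auto
    moreover have "uniform_limit (B N - P N) (\<lambda>n. f (n + N)) G sequentially
        = uniform_limit (B N - P N) (\<lambda>n. f (n + N)) F sequentially"
      using FG by (intro uniform_limit_cong') auto
    ultimately show ?thesis by simp
  qed
  have limF': "(\<lambda>n. deriv (f (n + N)) z) \<longlonglongrightarrow> deriv F z" if "z \<in> B N - P N" for z N
  proof (rule deriv_complex_uniform_limit[OF ulimF _ _ openBP that])
    have "f (n + N) holomorphic_on B N - P N" for n
      by (rule holomorphic_on_subset[OF holf]) (use PB in blast)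
    then show "\<forall>\<^sub>F n in sequentially. f (n + N) holomorphic_on B N - P N" by simp
  qed simp
  show ?thesis
  proof (rule that[of P\<omega> F])
    show "infinite P\<omega>"
    proof
      assume fin: "finite P\<omega>"
      have "card (P n) \<ge> n" for n
      proof (induction n)
        case (Suc n)
        then show ?case using psubset_card_mono[OF finP Pss[of n]] by linarith
      qed simp
      moreover have "card (P n) \<le> card P\<omega>" for n using fin by (intro card_mono) (auto simp: P\<omega>_def)
      ultimately show False by (metis not_less_eq_eq order_trans)
    qed
    show "P\<omega> \<subseteq> (\<Union>k. island l k)" using Pisl by (fastforce simp: P\<omega>_def)
    show "F p = 0" if "p \<in> P\<omega>" for p using that by (simp add: F_def)
    show "is_pole F p" if p: "p \<in> P\<omega>" for p
    proof -
      obtain N where N: "p \<in> B N" using ex_B by blast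
      have "(\<lambda>z. G z - f N z) analytic_on {p}" using holH openB N by (metis analytic_at)
      moreover have "is_pole (f N) p" using p N P\<omega>B polef by blast
      ultimately have "is_pole (\<lambda>z. f N z + (G z - f N z)) p" by (intro is_pole_add_analytic)
      then have "is_pole G p" by simp
      moreover have "\<forall>\<^sub>F z in at p. z \<in> B N - (P N - {p}) - {p}"
        using finP[of N] N openB
        by (intro eventually_at_in_open) (auto intro: finite_imp_closed)
      then have "\<forall>\<^sub>F z in at p. G z = F z"
        by eventually_elim (use FG[of _ N] in auto)
      ultimately show ?thesis by (rule is_pole_transform) simp
    qed
    show "F analytic_on {z}" if z: "z \<notin> P\<omega>" for z
    proof -
      obtain N where N: "z \<in> B N" using ex_B by blast
      then have "z \<in> B N - P N" using z P\<omega>B by blast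
      then show ?thesis using holF openBP by (metis analytic_at)
    qed
    show "norm (F z - of_real l * z) \<le> 1" if z: "z \<notin> (\<Union>k. island l k)" for z
    proof -
      have "norm (f n z - of_real l * z) \<le> 1" for n
      proof -
        have "norm (f n z - of_real l * z) \<le> 1 - (1 / 2) ^ n" using z by (intro closer) auto
        then show ?thesis using zero_le_power[of "1/2::real" n] by linarith
      qed
      then have "norm (G z - of_real l * z) \<le> 1"
        by (intro tendsto_upperbound[OF tendsto_norm[OF tendsto_diff[OF lim tendsto_const]]]) auto
      moreover have "z \<notin> P\<omega>" using z Pisl by (fastforce simp: P\<omega>_def)
      ultimately show ?thesis by (simp add: F_def)
    qed

    \<comment> \<open>Critical points of the limit\<close>
    fix c assume c: "c \<notin> P\<omega>" "deriv F c = 0"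
    obtain N where N: "c \<in> B N" using ex_B by blast
    have cP: "c \<notin> P n" for n using c by (auto simp: P\<omega>_def)
    \<comment> \<open>\<open>1 / 2 + (1 / 2) ^ Suc n\<close> is an explicit lower bound for the
      partial products of \<open>1 - (1 / 2) ^ (k + 2)\<close>. It is 1 for \<open>n = 0\<close>,
      and its limit 1/2 is positive, so \<open>deriv F c = 0\<close> forces
      \<open>deriv (f N) c = 0\<close>.\<close>
    have "norm (deriv (f (n + N)) c) \<ge> (1 / 2 + (1 / 2) ^ Suc n) * norm (deriv (f N) c)" for n
    proof (induction n)
      case (Suc n)
      define a where "a = (1 / 2 :: real) ^ Suc n"
      have a: "0 < a" "a \<le> 1 / 2" by (auto simp: a_def power_le_one)
      have "c \<in> cball 0 (2 * l ^ (n + N))"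
      proof -
        have "l ^ N \<le> l ^ (n + N)" using l by (intro power_increasing) auto
        moreover have "norm c < 2 * l ^ N" using N by (simp add: B_def)
        ultimately have "norm c \<le> 2 * l ^ (n + N)" by linarith
        then show ?thesis by simp
      qed
      then have 1: "norm (deriv (f (Suc (n + N))) c) \<ge> (1 - (1 / 2) ^ (n + N + 2)) * norm (deriv (f (n + N)) c)"
        using cP by (intro lower) auto
      have "(1 / 2 :: real) ^ (n + N + 2) \<le> (1 / 2) ^ (n + 2)" by (intro power_decreasing) auto
      then have 2: "1 - a / 2 \<le> 1 - (1 / 2) ^ (n + N + 2)" by (simp add: a_def)
      have "1 / 2 + (1 / 2) ^ Suc (Suc n) = 1 / 2 + a / 2" by (simp add: a_def)
      also have "\<dots> \<le> (1 - a / 2) * (1 / 2 + a)"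
      proof -
        have "a * a \<le> a * (1 / 2)" using a by (intro mult_left_mono) auto
        then show ?thesis by (simp add: algebra_simps)
      qed
      finally have "(1 / 2 + (1 / 2) ^ Suc (Suc n)) * norm (deriv (f N) c) \<le> (1 - a / 2) * (1 / 2 + a) * norm (deriv (f N) c)"
        by (intro mult_right_mono) auto
      also have "\<dots> = (1 - a / 2) * ((1 / 2 + a) * norm (deriv (f N) c))" by simp
      also have "\<dots> \<le> (1 - (1 / 2) ^ (n + N + 2)) * norm (deriv (f (n + N)) c)"
        using 2 a by (intro mult_mono Suc.IH[folded a_def] mult_nonneg_nonneg) (linarith | simp)+
      finally show ?case using 1 by simp
    qed simp
    then have "norm (deriv (f (n + N)) c) \<ge> 1 / 2 * norm (deriv (f N) c)" for n
      by (rule order_trans[rotated]) (intro mult_right_mono, auto)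
    then have "norm (deriv F c) \<ge> 1 / 2 * norm (deriv (f N) c)"
      using limF'[of c N] N cP by (intro tendsto_lowerbound[OF tendsto_norm[OF limF'[of c N]]]) auto
    then have dN: "deriv (f N) c = 0" using c by simp
    have main: "deriv (f (n + N)) c = 0 \<and> f (n + N) c = f N c" for n
    proof (induction n)
      case (Suc n)
      then show ?case using keep[of c "n + N"] cP by simp
    qed (use dN in simp)
    \<comment> \<open>The shift to \<open>Suc N\<close> matters: \<open>c\<close> may lie in island
      \<open>N\<close>, in which case its cycle is created only in the step to stage
      \<open>Suc N\<close>.\<close>
    have isl: "c \<notin> island l (n + Suc N)" for n using N B_isl[of N "n + N"] by auto
    define v where "v = f N c"
    define d where "d = f (Suc N) v"
    have fv: "f (n + Suc N) c = v" "deriv (f (n + Suc N)) c = 0" for n using main[of "Suc n"] by (auto simp: v_def)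
    have fd: "f (n + Suc N) v = d" for n
    proof (induction n)
      case (Suc n)
      have "f (Suc (n + Suc N)) (f (n + Suc N) c) = f (n + Suc N) (f (n + Suc N) c)"
        using keep[OF cP fv(2), of n] isl[of n] by blast
      then show ?case using Suc by (simp only: fv) simp
    qed (simp add: d_def)
    have cy: "v \<notin> P (n + Suc N)" "d \<notin> P (n + Suc N)" "deriv (f (n + Suc N)) d = 0" "f (n + Suc N) d = v" "d \<noteq> v" for n
      using cyc[OF cP fv(2) isl, of n] unfolding fv fd by auto
    have notP: "x \<notin> P\<omega>" if "\<And>n. x \<notin> P (n + Suc N)" for x
    proof
      assume "x \<in> P\<omega>"
      then obtain m where "x \<in> P m" by (auto simp: P\<omega>_def)
      then have "x \<in> P (m + Suc N)" using Pmono[OF le_add1] by blast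
      then show False using that by blast
    qed
    have vd: "v \<notin> P\<omega>" "d \<notin> P\<omega>" by (rule notP, rule cy)+
    have lim': "G x = y" if "\<And>n. f (n + Suc N) x = y" for x y
      using LIMSEQ_ignore_initial_segment[OF lim[of x], of "Suc N"] that by (simp add: LIMSEQ_const_iff)
    have F: "F c = v" "F v = d" "F d = v"
      using lim' fv fd cy c vd by (auto simp: F_def)
    have "deriv F d = 0"
    proof -
      \<comment> \<open>The disc \<open>B N\<close> was chosen for \<open>c\<close>; convergence of
        derivatives at \<open>d\<close> is taken on a disc of its own.\<close>
      obtain N2 where N2: "d \<in> B N2" using ex_B by blast
      then have "d \<in> B N2 - P N2" using vd P\<omega>B by blast
      then have "(\<lambda>n. deriv (f (n + N2)) d) \<longlonglongrightarrow> deriv F d" by (rule limF')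
      then have "(\<lambda>n. deriv (f (n + Suc N + N2)) d) \<longlonglongrightarrow> deriv F d"
        by (rule LIMSEQ_ignore_initial_segment)
      moreover have "deriv (f (n + Suc N + N2)) d = 0" for n
        using cy(3)[of "n + N2"] by (simp add: add_ac)
      ultimately show ?thesis by (simp add: LIMSEQ_const_iff)
    qed
    then show "F c \<notin> P\<omega> \<and> F (F c) \<notin> P\<omega> \<and> F (F (F c)) = F c \<and> deriv F (F (F c)) = 0 \<and> F (F c) \<noteq> F c"
      using F vd cy by simp
  qed
qed

section \<open>Fatou sets of meromorphic functions\<close>

lemma nicely_meromorphic_analytic_at:
  "f nicely_meromorphic_on UNIV \<Longrightarrow> \<not> is_pole f z \<Longrightarrow> f analytic_on {z}"
  by (rule nicely_meromorphic_on_imp_analytic_at) auto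

text \<open>Poles are isolated, so they form a closed countable set, and removing a countable set
  leaves the plane connected. This prepares the open mapping theorem.\<close>

lemma complement_of_poles:
  assumes "f nicely_meromorphic_on UNIV"
  shows "open (- {z. is_pole f z})" "connected (- {z. is_pole f z})" "f holomorphic_on - {z. is_pole f z}"
proof -
  have an: "f analytic_on - {z. is_pole f z}"
    using nicely_meromorphic_analytic_at[OF assms] by (subst analytic_on_analytic_at) auto
  then show "f holomorphic_on - {z. is_pole f z}" by (rule analytic_imp_holomorphic)
  have ev: "\<forall>\<^sub>F w in at z. \<not> is_pole f w" for z
  proof -
    have "isolated_singularity_at f z"
      using assms unfolding nicely_meromorphic_on_def
      by (metis UNIV_I empty_subsetI insert_subset meromorphic_at_iff meromorphic_on_subset)
    then obtain r where r: "r > 0" "f analytic_on ball z r - {z}" unfolding isolated_singularity_at_def by blast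
    have "\<forall>\<^sub>F w in at z. w \<in> ball z r - {z}" using r(1) by (intro eventually_at_in_open) auto
    then show ?thesis
    proof eventually_elim
      case (elim w)
      then have "f analytic_on {w}" using r(2) analytic_on_subset by blast
      then show ?case by (rule analytic_at_imp_no_pole)
    qed
  qed
  have sp: "{z. is_pole f z} sparse_in UNIV"
    using ev by (subst sparse_in_eventually_iff) auto
  then have "countable {z. is_pole f z}" using sparse_imp_countable[OF open_UNIV sp] by simp
  then show "connected (- {z. is_pole f z})"
    using connected_open_diff_countable[of "UNIV::complex set" "{z. is_pole f z}"]
    by (simp add: Compl_eq_Diff_UNIV connected_UNIV)
  have "closed {z. is_pole f z}"
    using sp by (simp add: sparse_in_open closed_limpt)
  then show "open (- {z. is_pole f z})" by (rule open_Compl)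
qed

text \<open>Off the roots of \<open>q\<close> the function agrees locally with an analytic quotient.
  Infinitely many poles therefore imply transcendence.\<close>

lemma rational_map_finite_poles:
  assumes "rational_map f"
  shows "finite {z. is_pole f z}"
proof -
  obtain p q :: "complex poly" where q: "q \<noteq> 0" and f: "\<And>z. poly q z \<noteq> 0 \<Longrightarrow> f z = poly p z / poly q z"
    using assms unfolding rational_map_def by blast
  have fin: "finite {z. poly q z = 0}" using q by (rule poly_roots_finite)
  have "poly q z = 0" if "is_pole f z" for z
  proof (rule ccontr)
    assume nz: "poly q z \<noteq> 0"
    have "open (- {z. poly q z = 0})" using fin by (intro open_Compl finite_imp_closed)
    then have "\<forall>\<^sub>F w in at z. w \<in> - {z. poly q z = 0} - {z}" using nz by (intro eventually_at_in_open) auto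
    then have "\<forall>\<^sub>F w in at z. f w = poly p w / poly q w" by eventually_elim (use f in auto)
    then have "is_pole (\<lambda>w. poly p w / poly q w) z" by (rule is_pole_transform[OF that]) simp
    moreover have "(\<lambda>w. poly p w / poly q w) analytic_on {z}"
    proof (intro analytic_on_divide)
      have "poly p analytic_on UNIV" for p :: "complex poly"
        unfolding analytic_on_open[OF open_UNIV] holomorphic_on_def field_differentiable_def
        using poly_DERIV by blast
      then show "poly p analytic_on {z}" "poly q analytic_on {z}" using analytic_on_subset by blast+
    qed (use nz in simp)
    ultimately show False using analytic_at_imp_no_pole by blast
  qed
  then show ?thesis using fin by (metis (mono_tags, lifting) Collect_mono finite_subset)
qed

lemma critical_point_deriv_zero:
  assumes "f nicely_meromorphic_on UNIV" "critical_point f c" "\<not> is_pole f c"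
  shows "deriv f c = 0"
proof (rule ccontr)
  assume "deriv f c \<noteq> 0"
  then obtain r where "r > 0" "inj_on f (ball c r)"
    using has_complex_derivative_locally_injective[OF complement_of_poles(3)[OF assms(1)] _ complement_of_poles(1)[OF assms(1)], of c]
      assms(3) by auto
  then show False using assms(2) unfolding critical_point_def by (meson centre_in_ball open_ball)
qed

section \<open>Convergence to infinity on the sphere\<close>

lemma continuous_on_to_sphere: "continuous_on A to_sphere"
proof -
  have "1 + (norm z)\<^sup>2 \<noteq> 0" "(norm z)\<^sup>2 + 1 \<noteq> 0" for z :: complex
    by (simp_all add: add_nonneg_eq_0_iff sum_power2_eq_zero_iff add_eq_0_iff_both_eq_0)
  then show ?thesis unfolding to_sphere_def by (intro continuous_intros) auto
qed

lemma dist_to_sphere_infinity: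
  assumes "norm z \<ge> 1"
  shows "dist (to_sphere z) (0, 1) \<le> 4 / norm z"
proof -
  have p: "1 + (norm z)\<^sup>2 > 0" "norm z > 0" using assms by (auto intro: add_pos_nonneg)
  have "to_sphere z - (0, 1) = ((2 / (1 + (norm z)\<^sup>2)) *\<^sub>R z, - 2 / (1 + (norm z)\<^sup>2))"
    using p by (simp add: to_sphere_def field_simps)
  then have "dist (to_sphere z) (0, 1) \<le> norm ((2 / (1 + (norm z)\<^sup>2)) *\<^sub>R z) + norm (- 2 / (1 + (norm z)\<^sup>2))"
    by (metis dist_norm norm_Pair_le)
  also have "\<dots> = (2 * norm z + 2) / (1 + (norm z)\<^sup>2)"
    using p by (simp add: add_divide_distrib)
  also have "\<dots> \<le> (4 * norm z) / (norm z)\<^sup>2"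
    using assms p by (intro frac_le) auto
  also have "\<dots> = 4 / norm z" using p by (simp add: power2_eq_square)
  finally show ?thesis .
qed

text \<open>The height on the sphere separates the closed unit disc from infinity, whose height is
  1.\<close>

lemma snd_to_sphere_nonpos: "norm z \<le> 1 \<Longrightarrow> snd (to_sphere z) \<le> 0"
  by (auto simp: to_sphere_def intro!: divide_nonpos_nonneg simp: power_le_one)

lemma to_sphere_tendsto_infinity:
  fixes s :: "nat \<Rightarrow> complex"
  assumes "filterlim s at_infinity sequentially"
  shows "(\<lambda>k. to_sphere (s k)) \<longlonglongrightarrow> (0, 1)"
proof -
  have n: "filterlim (\<lambda>k. norm (s k)) at_top sequentially"
    using assms by (rule filterlim_at_infinity_imp_norm_at_top)
  have "(\<lambda>k. 4 / norm (s k)) \<longlonglongrightarrow> 0"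
    by (intro real_tendsto_divide_at_top[OF tendsto_const n])
  moreover have "\<forall>\<^sub>F k in sequentially. norm (s k) \<ge> 1" using n by (simp add: filterlim_at_top)
  then have "\<forall>\<^sub>F k in sequentially. norm (dist (to_sphere (s k)) (0, 1)) \<le> 4 / norm (s k)"
    by eventually_elim (use dist_to_sphere_infinity in auto)
  ultimately have "(\<lambda>k. dist (to_sphere (s k)) (0, 1)) \<longlonglongrightarrow> 0" by (rule Lim_null_comparison[rotated])
  then show ?thesis by (subst tendsto_dist_iff)
qed

lemma filterlim_sequentially_shift:
  "filterlim (\<lambda>n. s (n + k)) F sequentially \<longleftrightarrow> filterlim s F sequentially"
  by (simp add: filterlim_iff eventually_sequentially_seg[of "\<lambda>n. P (s n)" for P])

text \<open>
  Any spherical limit of the \<open>g n\<close> is infinite at \<open>z\<close> by continuity, so \<open>1 / g n\<close> is bounded near \<open>z\<close>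
  for large \<open>n\<close>. By Montel its limits are holomorphic, and they vanish on the nonempty open set
  where \<open>E\<close> meets this neighbourhood.
\<close>

lemma normal_family_escape_open:
  fixes g :: "nat \<Rightarrow> complex \<Rightarrow> complex"
  assumes N: "open N" "z \<in> N" "normal_family_on N (range g)" and hol: "\<And>n. g n holomorphic_on N"
    and E: "open E" "z \<in> closure E" "\<And>w. w \<in> E \<Longrightarrow> filterlim (\<lambda>n. g n w) at_infinity sequentially"
  shows "\<exists>\<rho>>0. ball z \<rho> \<subseteq> N \<and> (\<forall>w\<in>ball z \<rho>. filterlim (\<lambda>n. g n w) at_infinity sequentially)"
proof -
  obtain r where r: "r > 0" "cball z r \<subseteq> N" using N open_contains_cball by blast
  have cont: "continuous_on (cball z r) (g n)" for n
    using hol r by (meson holomorphic_on_imp_continuous_on holomorphic_on_subset)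
  have "\<exists>K \<rho>. \<rho> > 0 \<and> (\<forall>n\<ge>K. \<forall>w\<in>ball z \<rho>. norm (g n w) > 1)"
  proof (rule ccontr)
    assume *: "\<not> ?thesis"
    have "\<exists>n w. n \<ge> j \<and> w \<in> ball z (inverse (Suc j)) \<and> norm (g n w) \<le> 1" for j
    proof -
      have "inverse (real (Suc j)) > 0" by simp
      then show ?thesis using * by (metis not_le)
    qed
    then obtain n w where nw: "\<And>j. n j \<ge> j" "\<And>j. w j \<in> ball z (inverse (Suc j))" "\<And>j. norm (g (n j) (w j)) \<le> 1"
      by metis
    have "range (\<lambda>j. g (n j)) \<subseteq> range g" by auto
    then obtain q G where q: "strict_mono q"
      and lim: "\<forall>K. compact K \<and> K \<subseteq> N \<longrightarrow> uniform_limit K (\<lambda>k z. to_sphere (g (n (q k)) z)) G sequentially"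
      using N(3) unfolding normal_family_on_def by blast
    have ul: "uniform_limit (cball z r) (\<lambda>k z. to_sphere (g (n (q k)) z)) G sequentially"
      using lim r by simp
    have contG: "continuous_on (cball z r) G"
    proof (rule uniform_limit_theorem[OF _ ul])
      show "\<forall>\<^sub>F k in sequentially. continuous_on (cball z r) (\<lambda>z. to_sphere (g (n (q k)) z))"
        by (intro always_eventually allI continuous_on_compose2[OF continuous_on_to_sphere cont]) auto
    qed simp
    have nq: "filterlim (\<lambda>k. n (q k)) at_top sequentially"
      using nw(1) seq_suble[OF q] by (intro filterlim_at_top_mono[OF filterlim_ident] always_eventually allI) (meson order_trans)
    have GE: "G y = (0, 1)" if "y \<in> E" "y \<in> cball z r" for y
    proof (rule LIMSEQ_unique)
      show "(\<lambda>k. to_sphere (g (n (q k)) y)) \<longlonglongrightarrow> G y" using tendsto_uniform_limitI[OF ul that(2)] .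
      show "(\<lambda>k. to_sphere (g (n (q k)) y)) \<longlonglongrightarrow> (0, 1)"
        using filterlim_compose[OF E(3)[OF that(1)] nq] by (intro to_sphere_tendsto_infinity)
    qed
    have "G z = (0, 1)"
    proof (rule continuous_constant_on_closure[of "E \<inter> ball z r" G])
      have "closure (E \<inter> ball z r) \<subseteq> cball z r"
        by (rule closure_minimal) auto
      then show "continuous_on (closure (E \<inter> ball z r)) G" using contG continuous_on_subset by blast
      show "z \<in> closure (E \<inter> ball z r)"
        using open_Int_closure_subset[of "ball z r" E] E(2) r(1) by (auto simp: Int_commute)
    qed (use GE in auto)
    have wz: "(\<lambda>k. w (q k)) \<longlonglongrightarrow> z"
    proof -
      have "norm (dist (w j) z) \<le> inverse (real (Suc j))" for j
        using nw(2)[of j] by (simp add: dist_commute del: of_nat_Suc)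
      then have "(\<lambda>j. dist (w j) z) \<longlonglongrightarrow> 0"
        by (intro Lim_null_comparison[OF always_eventually LIMSEQ_inverse_real_of_nat]) blast
      then have "w \<longlonglongrightarrow> z" by (subst tendsto_dist_iff)
      then show ?thesis using q LIMSEQ_subseq_LIMSEQ[of w z q] by (simp add: o_def)
    qed
    have "(\<lambda>k. to_sphere (g (n (q k)) (w (q k)))) \<longlonglongrightarrow> G z"
    proof (rule Lim_transform)
      have "\<forall>\<^sub>F k in sequentially. w (q k) \<in> ball z r"
        using topological_tendstoD[OF wz open_ball, of z r] r(1) by simp
      then have wr: "\<forall>\<^sub>F k in sequentially. w (q k) \<in> cball z r" by eventually_elim auto
      show "(\<lambda>k. G (w (q k))) \<longlonglongrightarrow> G z"
        by (rule continuous_on_tendsto_compose[OF contG wz _ wr]) (use r in simp)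
      show "(\<lambda>k. to_sphere (g (n (q k)) (w (q k))) - G (w (q k))) \<longlonglongrightarrow> 0"
      proof (rule tendstoI)
        fix e :: real assume "e > 0"
        from uniform_limitD[OF ul this] wr
        show "\<forall>\<^sub>F k in sequentially. dist (to_sphere (g (n (q k)) (w (q k))) - G (w (q k))) 0 < e"
          by eventually_elim (auto simp: dist_norm)
      qed
    qed
    then have "(\<lambda>k. snd (to_sphere (g (n (q k)) (w (q k))))) \<longlonglongrightarrow> 1"
      using tendsto_snd \<open>G z = (0, 1)\<close> by fastforce
    then have "1 \<le> (0::real)"
      by (rule tendsto_upperbound) (auto intro!: always_eventually snd_to_sphere_nonpos nw)
    then show False by simp
  qed
  then obtain K \<rho>0 where K: "\<rho>0 > 0" "\<And>n w. n \<ge> K \<Longrightarrow> w \<in> ball z \<rho>0 \<Longrightarrow> norm (g n w) > 1" by blast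
  define \<rho> where "\<rho> = min \<rho>0 r"
  have \<rho>: "\<rho> > 0" "ball z \<rho> \<subseteq> N" "ball z \<rho> \<subseteq> ball z \<rho>0" using r K by (auto simp: \<rho>_def)
  define u where "u n w = inverse (g (n + K) w)" for n w
  have gnz: "norm (g (n + K) w) > 1" if "w \<in> ball z \<rho>" for n w using K(2)[of "n + K" w] \<rho>(3) that by auto
  have gn0: "g (n + K) w \<noteq> 0" if "w \<in> ball z \<rho>" for n w using gnz[OF that, of n] by auto
  have holu: "u n holomorphic_on ball z \<rho>" for n
    unfolding u_def by (intro holomorphic_on_inverse holomorphic_on_subset[OF hol] \<rho> gn0)
  have bdu: "norm (u n w) \<le> 1" if "w \<in> ball z \<rho>" for n w
    using gnz[OF that, of n] by (simp add: u_def norm_inverse inverse_le_1_iff)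
  have "filterlim (\<lambda>n. g n w) at_infinity sequentially" if w: "w \<in> ball z \<rho>" for w
  proof (rule ccontr)
    assume *: "\<not> ?thesis"
    have "\<not> (\<lambda>n. u n w) \<longlonglongrightarrow> 0"
    proof
      assume "(\<lambda>n. u n w) \<longlonglongrightarrow> 0"
      then have "filterlim (\<lambda>n. inverse (u n w)) at_infinity sequentially"
        by (intro filterlim_inverse_at_infinity[THEN filterlim_compose] filterlim_atI)
           (use gn0[OF w] in \<open>simp_all add: u_def\<close>)
      then have "filterlim (\<lambda>n. g (n + K) w) at_infinity sequentially" by (simp add: u_def)
      then show False using * filterlim_sequentially_shift[of "\<lambda>n. g n w"] by blast
    qed
    \<comment> \<open>A failure at \<open>w\<close> leaves a subsequence along which
      \<open>|u|\<close> stays at least \<open>e\<close> at \<open>w\<close>. Its Montel limit would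
      be nonzero at \<open>w\<close>, yet it vanishes on an open set.\<close>
    then obtain e where e: "e > 0" "\<exists>\<^sub>F n in sequentially. norm (u n w) \<ge> e"
      by (auto simp: tendsto_iff not_eventually not_less)
    have "infinite {n. norm (u n w) \<ge> e}"
      using e(2) unfolding cofinite_eq_sequentially[symmetric] frequently_cofinite .
    from infinite_enumerate[OF this] obtain q :: "nat \<Rightarrow> nat" where q: "strict_mono q" "\<And>k. norm (u (q k) w) \<ge> e"
      by auto
    obtain h p where h: "h holomorphic_on ball z \<rho>" and p: "strict_mono p"
      and lim: "\<And>x. x \<in> ball z \<rho> \<Longrightarrow> (\<lambda>k. u (q (p k)) x) \<longlonglongrightarrow> h x"
    proof (rule Montel[of "ball z \<rho>" "range u" "\<lambda>k. u (q k)"])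
      show "\<exists>B. \<forall>h\<in>range u. \<forall>x\<in>K. norm (h x) \<le> B" if "compact K" "K \<subseteq> ball z \<rho>" for K
      proof (intro exI ballI)
        fix h x assume "h \<in> range u" "x \<in> K"
        then show "norm (h x) \<le> 1" using bdu that(2) by blast
      qed
      show "h holomorphic_on ball z \<rho>" if "h \<in> range u" for h using that holu by blast
    qed (simp, blast, rule that)
    have h0: "h x = 0" if "x \<in> E \<inter> ball z \<rho>" for x
    proof (rule LIMSEQ_unique)
      show "(\<lambda>k. u (q (p k)) x) \<longlonglongrightarrow> h x" using lim that by auto
      have "filterlim (\<lambda>n. g (n + K) x) at_infinity sequentially"
        using E(3)[of x] that filterlim_sequentially_shift[of "\<lambda>n. g n x"] by blast
      then have "(\<lambda>n. u n x) \<longlonglongrightarrow> 0"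
        unfolding u_def by (rule filterlim_compose[OF tendsto_inverse_0])
      then show "(\<lambda>k. u (q (p k)) x) \<longlonglongrightarrow> 0"
        using LIMSEQ_subseq_LIMSEQ[of "\<lambda>n. u n x" 0 "q \<circ> p"] q p strict_mono_o by (auto simp: o_def)
    qed
    have ne: "E \<inter> ball z \<rho> \<noteq> {}"
    proof -
      obtain y where "y \<in> E" "dist y z < \<rho>" using E(2) \<rho>(1) unfolding closure_approachable by blast
      then show ?thesis by (auto simp: dist_commute)
    qed
    have "h w = 0"
    proof (rule analytic_continuation_open[of "E \<inter> ball z \<rho>" "ball z \<rho>" h "\<lambda>_. 0"])
      show "open (E \<inter> ball z \<rho>)" using E(1) by (rule open_Int) simp
      show "h x = 0" if "x \<in> E \<inter> ball z \<rho>" for x using h0[OF that] .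
    qed (use ne h w in simp_all)
    then have "(\<lambda>k. norm (u (q (p k)) w)) \<longlonglongrightarrow> 0" using tendsto_norm_zero[of _ sequentially] lim[OF w] by metis
    then have "0 \<ge> e" by (rule tendsto_lowerbound[OF _ always_eventually]) (simp_all add: q)
    then show False using e by simp
  qed
  then show ?thesis using \<rho> by blast
qed

section \<open>Invariance of the Fatou set and escape on components\<close>

lemma Fatou_set_open: "open (Fatou_set f)"
proof (subst open_subopen, intro ballI)
  fix z assume "z \<in> Fatou_set f"
  then obtain N where N: "open N" "z \<in> N" "\<forall>w\<in>N. \<forall>n. \<not> is_pole f ((f ^^ n) w)"
    "normal_family_on N (range (\<lambda>n. f ^^ n))" unfolding Fatou_set_def by blast
  then have "N \<subseteq> Fatou_set f" unfolding Fatou_set_def by blast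
  then show "\<exists>T. open T \<and> z \<in> T \<and> T \<subseteq> Fatou_set f" using N by blast
qed

lemma Fatou_set_not_pole: "z \<in> Fatou_set f \<Longrightarrow> \<not> is_pole f ((f ^^ n) z)"
  unfolding Fatou_set_def by blast

lemma iterates_analytic_on_Fatou_set:
  assumes "f nicely_meromorphic_on UNIV"
  shows "(f ^^ n) analytic_on Fatou_set f"
proof (induction n)
  case (Suc n)
  have "f analytic_on (f ^^ n) ` Fatou_set f"
  proof (subst analytic_on_analytic_at, intro ballI)
    fix y assume "y \<in> (f ^^ n) ` Fatou_set f"
    then show "f analytic_on {y}"
      using Fatou_set_not_pole nicely_meromorphic_analytic_at[OF assms] by blast
  qed
  from analytic_on_compose[OF Suc.IH this] show ?case by (simp only: funpow.simps)
qed simp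

text \<open>Since \<open>f\<close> is not constant, the image of a small disc is open;
  \<open>f ^^ m\<close> on the image corresponds to \<open>f ^^ Suc m\<close> on the disc.\<close>

lemma Fatou_set_image:
  assumes mero: "f nicely_meromorphic_on UNIV" and nc: "\<not> f constant_on - {z. is_pole f z}"
    and z: "z \<in> Fatou_set f"
  shows "f z \<in> Fatou_set f"
proof -
  obtain N where N: "open N" "z \<in> N" "\<And>w n. w \<in> N \<Longrightarrow> \<not> is_pole f ((f ^^ n) w)"
    "normal_family_on N (range (\<lambda>n. f ^^ n))" using z unfolding Fatou_set_def by blast
  obtain r where r: "r > 0" "cball z r \<subseteq> N" using N open_contains_cball by blast
  define B where "B = ball z r"
  have BN: "B \<subseteq> N" "B \<subseteq> cball z r" using r by (auto simp: B_def)
  have "\<not> is_pole f w" if "w \<in> N" for w using N(3)[OF that, of 0] by simp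
  then have "open (f ` B)"
    using complement_of_poles[OF mero] nc BN by (intro open_mapping_thm[of f "- {z. is_pole f z}"]) (auto simp: B_def)
  moreover have "f z \<in> f ` B" using r by (simp add: B_def)
  moreover have "\<not> is_pole f ((f ^^ n) w)" if w: "w \<in> f ` B" for w n
  proof -
    obtain x where "x \<in> B" "w = f x" using w by blast
    then show ?thesis using N(3)[of x "Suc n"] BN by (simp add: funpow_swap1 subsetD)
  qed
  moreover have "normal_family_on (f ` B) (range (\<lambda>n. f ^^ n))"
    unfolding normal_family_on_def
  proof (intro allI impI)
    fix s :: "nat \<Rightarrow> complex \<Rightarrow> complex" assume "range s \<subseteq> range (\<lambda>n. f ^^ n)"
    then have "\<forall>k. \<exists>m. s k = f ^^ m" by blast
    then obtain m where m: "\<And>k. s k = f ^^ m k" by metis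
    have "range (\<lambda>k. f ^^ Suc (m k)) \<subseteq> range (\<lambda>n. f ^^ n)" by blast
    then obtain q G where q: "strict_mono q"
      and lim: "\<forall>K. compact K \<and> K \<subseteq> N \<longrightarrow> uniform_limit K (\<lambda>k w. to_sphere ((f ^^ Suc (m (q k))) w)) G sequentially"
      using N(4)[unfolded normal_family_on_def, THEN spec, of "\<lambda>k. f ^^ Suc (m k)"] by blast
    have "uniform_limit (cball z r) (\<lambda>k w. to_sphere ((f ^^ Suc (m (q k))) w)) G sequentially"
      using lim r(2) by simp
    then have ul: "uniform_limit B (\<lambda>k w. to_sphere ((f ^^ Suc (m (q k))) w)) G sequentially"
      using BN(2) by (rule uniform_limit_on_subset)
    define x where "x y = (SOME x. x \<in> B \<and> f x = y)" for y
    have x: "x y \<in> B" "f (x y) = y" if "y \<in> f ` B" for y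
      using someI_ex[of "\<lambda>x. x \<in> B \<and> f x = y"] that unfolding x_def by auto
    have ul': "uniform_limit (f ` B) (\<lambda>k y. to_sphere (s (q k) y)) (\<lambda>y. G (x y)) sequentially"
    proof (rule uniform_limitI)
      fix e :: real assume "e > 0"
      from uniform_limitD[OF ul this]
      show "\<forall>\<^sub>F k in sequentially. \<forall>y\<in>f ` B. dist (to_sphere (s (q k) y)) (G (x y)) < e"
      proof eventually_elim
        case (elim k)
        show ?case
        proof
          fix y assume y: "y \<in> f ` B"
          have "(f ^^ Suc (m (q k))) (x y) = s (q k) y"
            using x(2)[OF y] by (simp add: m funpow_swap1)
          then show "dist (to_sphere (s (q k) y)) (G (x y)) < e" using elim x(1)[OF y] by fastforce
        qed
      qed
    qed
    show "\<exists>r g. strict_mono r \<and> (\<forall>K. compact K \<and> K \<subseteq> f ` B \<longrightarrow>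
        uniform_limit K (\<lambda>k z. to_sphere (s (r k) z)) g sequentially)"
      using q ul' uniform_limit_on_subset by blast
  qed
  ultimately show ?thesis unfolding Fatou_set_def by blast
qed

text \<open>A sequence of iterates either repeats one exponent infinitely often, giving a constant
  subsequence, or has exponents tending to infinity, and then converges uniformly to the north
  pole.\<close>

lemma uniformly_escaping_subset_Fatou_set:
  fixes a :: "nat \<Rightarrow> real"
  assumes W: "open W" "f ` W \<subseteq> W" "\<And>w. w \<in> W \<Longrightarrow> \<not> is_pole f w"
    and a: "filterlim a at_top sequentially" "\<And>n w. w \<in> W \<Longrightarrow> a n \<le> norm ((f ^^ n) w)"
  shows "W \<subseteq> Fatou_set f"
proof -
  have inW: "(f ^^ n) w \<in> W" if "w \<in> W" for n w
    using that W(2) by (induction n) auto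
  have "normal_family_on W (range (\<lambda>n. f ^^ n))"
    unfolding normal_family_on_def
  proof (intro allI impI)
    fix s :: "nat \<Rightarrow> complex \<Rightarrow> complex" assume "range s \<subseteq> range (\<lambda>n. f ^^ n)"
    then have "\<forall>k. \<exists>m. s k = f ^^ m" by blast
    then obtain m where m: "\<And>k. s k = f ^^ m k" by metis
    show "\<exists>r g. strict_mono r \<and> (\<forall>K. compact K \<and> K \<subseteq> W \<longrightarrow>
        uniform_limit K (\<lambda>k z. to_sphere (s (r k) z)) g sequentially)"
    proof (cases "\<exists>i. infinite {k. m k = i}")
      case True
      then obtain i where "infinite {k. m k = i}" by blast
      from infinite_enumerate[OF this] obtain r :: "nat \<Rightarrow> nat" where r: "strict_mono r" "\<And>k. m (r k) = i" by auto
      have "uniform_limit K (\<lambda>k z. to_sphere (s (r k) z)) (\<lambda>z. to_sphere ((f ^^ i) z)) sequentially" for K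
        by (simp add: m r(2) uniform_limit_const)
      then show ?thesis using r(1) by blast
    next
      case False
      have "filterlim m at_top sequentially"
      proof (subst filterlim_at_top, intro allI)
        fix Z
        have "finite (\<Union>i<Z. {k. m k = i})" using False by (intro finite_UN_I) auto
        moreover have "{k. \<not> Z \<le> m k} = (\<Union>i<Z. {k. m k = i})" by auto
        ultimately show "\<forall>\<^sub>F k in sequentially. Z \<le> m k"
          unfolding cofinite_eq_sequentially[symmetric] eventually_cofinite by simp
      qed
      then have am: "filterlim (\<lambda>k. a (m k)) at_top sequentially" by (rule filterlim_compose[OF a(1)])
      have "uniform_limit W (\<lambda>k z. to_sphere (s k z)) (\<lambda>z. (0, 1)) sequentially"
      proof (rule uniform_limitI)
        fix e :: real assume e: "e > 0"
        have "\<forall>\<^sub>F k in sequentially. a (m k) \<ge> max 1 (8 / e)" using am by (simp only: filterlim_at_top)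
        then show "\<forall>\<^sub>F k in sequentially. \<forall>z\<in>W. dist (to_sphere (s k z)) (0, 1) < e"
        proof eventually_elim
          case (elim k)
          show ?case
          proof
            fix z assume "z \<in> W"
            then have n: "norm (s k z) \<ge> max 1 (8 / e)" using a(2)[of z "m k"] elim by (simp add: m)
            then have "dist (to_sphere (s k z)) (0, 1) \<le> 4 / norm (s k z)" by (intro dist_to_sphere_infinity) simp
            also have "\<dots> \<le> 4 / (8 / e)" using n e by (intro divide_left_mono mult_pos_pos) (auto intro: less_le_trans)
            also have "\<dots> < e" using e by simp
            finally show "dist (to_sphere (s k z)) (0, 1) < e" .
          qed
        qed
      qed
      then have "\<forall>K. compact K \<and> K \<subseteq> W \<longrightarrow> uniform_limit K (\<lambda>k z. to_sphere (s (id k) z)) (\<lambda>z. (0, 1)) sequentially"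
        using uniform_limit_on_subset by fastforce
      moreover have "strict_mono (id :: nat \<Rightarrow> nat)" by (simp add: strict_mono_def)
      ultimately show ?thesis by blast
    qed
  qed
  then show ?thesis using W inW unfolding Fatou_set_def by blast
qed

text \<open>The interior of the escaping set is open, and by
  \<open>normal_family_escape_open\<close> it is relatively closed in \<open>D\<close>;
  connectedness does the rest.\<close>

lemma Fatou_component_escape:
  assumes mero: "f nicely_meromorphic_on UNIV"
    and D: "connected D" "open D" "D \<subseteq> Fatou_set f"
    and E: "open E" "E \<noteq> {}" "E \<subseteq> D" "\<And>w. w \<in> E \<Longrightarrow> filterlim (\<lambda>n. (f ^^ n) w) at_infinity sequentially"
    and z: "z \<in> D"
  shows "filterlim (\<lambda>n. (f ^^ n) z) at_infinity sequentially"
proof -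
  define X where "X = D \<inter> interior {w. filterlim (\<lambda>n. (f ^^ n) w) at_infinity sequentially}"
  have opX: "open X" using D by (simp add: X_def open_Int)
  have "X \<noteq> {}" using E interior_maximal[OF _ E(1), of "{w. filterlim (\<lambda>n. (f ^^ n) w) at_infinity sequentially}"]
    by (auto simp: X_def)
  have "D \<inter> closure X \<subseteq> X"
  proof
    fix x assume x: "x \<in> D \<inter> closure X"
    then obtain N where N: "open N" "x \<in> N" "\<forall>w\<in>N. \<forall>n. \<not> is_pole f ((f ^^ n) w)"
      "normal_family_on N (range (\<lambda>n. f ^^ n))" using D unfolding Fatou_set_def by blast
    then have "N \<subseteq> Fatou_set f" unfolding Fatou_set_def by blast
    then have hol: "(f ^^ n) holomorphic_on N" for n
      using iterates_analytic_on_Fatou_set[OF mero] analytic_on_subset analytic_imp_holomorphic by blast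
    obtain \<rho> where \<rho>: "\<rho> > 0" "\<And>w. w \<in> ball x \<rho> \<Longrightarrow> filterlim (\<lambda>n. (f ^^ n) w) at_infinity sequentially"
    proof -
      have "filterlim (\<lambda>n. (f ^^ n) w) at_infinity sequentially" if "w \<in> X" for w
        using that interior_subset unfolding X_def by blast
      from normal_family_escape_open[OF N(1,2,4) hol opX _ this] x show ?thesis using that by blast
    qed
    then have "ball x \<rho> \<subseteq> interior {w. filterlim (\<lambda>n. (f ^^ n) w) at_infinity sequentially}"
      by (intro interior_maximal) auto
    then show "x \<in> X" using \<rho>(1) x by (auto simp: X_def)
  qed
  then have "X = D \<inter> closure X" using closure_subset[of X] by (auto simp: X_def)
  then have "closedin (top_of_set D) X" by (metis closed_closure closedin_closed_Int)
  moreover have "openin (top_of_set D) X" using opX by (auto simp: X_def openin_open_eq D)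
  ultimately have "X = D" using D(1) \<open>X \<noteq> {}\<close> by (simp add: connected_clopen) blast
  then show ?thesis using z interior_subset unfolding X_def by blast
qed

section \<open>The Baker domain\<close>

text \<open>The \<open>+ 1\<close> mirrors the \<open>- 1\<close> in \<open>island\<close>: under
  multiplication by \<open>l\<close> it grows to \<open>l\<close>, so an error of 1 cannot push a
  point back into an excluded disc.\<close>

definition gaps :: "real \<Rightarrow> complex set" where
  "gaps l = {z. norm z > 1 \<and> (\<forall>k. norm (z - of_real (l ^ k)) > l ^ k / 8 + 1)}"

text \<open>Infinitely many closed conditions are excluded, but near a given point those with large
  \<open>l ^ k\<close> hold automatically, and the finitely many others are open.\<close>

lemma open_gaps:
  assumes "l \<ge> 32"
  shows "open (gaps l)"
proof (subst open_subopen, intro ballI)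
  fix z assume z: "z \<in> gaps l"
  obtain K where K: "4 * (norm z + 1) + 4 < l ^ K" using real_arch_pow[of l] assms by auto
  define T where "T = ball z 1 \<inter> {w. norm w > 1} \<inter> (\<Inter>k<K. {w. norm (w - of_real (l ^ k)) > l ^ k / 8 + 1})"
  have "open T" unfolding T_def
    by (intro open_Int open_INT ballI open_Collect_less continuous_intros) auto
  moreover have "z \<in> T" using z by (auto simp: T_def gaps_def)
  moreover have "T \<subseteq> gaps l"
  proof
    fix w assume w: "w \<in> T"
    have "norm (w - of_real (l ^ k)) > l ^ k / 8 + 1" for k
    proof (cases "k < K")
      case True
      then show ?thesis using w by (auto simp: T_def)
    next
      case False
      then have "l ^ K \<le> l ^ k" using assms by (intro power_increasing) auto
      moreover have "norm (z - w) < 1" using w by (simp add: T_def dist_norm)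
      then have "norm w < norm z + 1" using norm_triangle_ineq2[of w z] by (simp add: norm_minus_commute)
      moreover have "norm (w - of_real (l ^ k)) \<ge> l ^ k - norm w"
        using norm_triangle_ineq2[of "of_real (l ^ k)" w] assms by (simp add: norm_minus_commute norm_power)
      moreover have "4 * (norm z + 1) + 4 < l ^ k" using calculation(1) K by linarith
      moreover have "x / 8 + 1 < y" if "b < c + 1" "x - b \<le> y" "4 * (c + 1) + 4 < x" "0 \<le> c" for b c x y :: real
        using that by argo
      ultimately show ?thesis using norm_ge_zero by blast
    qed
    then show "w \<in> gaps l" using w by (auto simp: gaps_def T_def)
  qed
  ultimately show "\<exists>T. open T \<and> z \<in> T \<and> T \<subseteq> gaps l" by blast
qed

lemma gaps_island_disjoint: "gaps l \<inter> (\<Union>k. island l k) = {}"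
proof -
  have "z \<notin> island l k" if "z \<in> gaps l" for z k
  proof -
    have "norm (z - of_real (l ^ k)) > l ^ k / 8 + 1" using that by (auto simp: gaps_def)
    then show ?thesis by (simp add: island_def dist_norm norm_minus_commute)
  qed
  then show ?thesis by blast
qed

lemma gaps_image:
  assumes l: "l \<ge> 32" and z: "z \<in> gaps l" and w: "norm (w - of_real l * z) \<le> 1"
  shows "w \<in> gaps l" "norm w \<ge> 2 * norm z"
proof -
  have z1: "norm z > 1" and zk: "\<And>k. norm (z - of_real (l ^ k)) > l ^ k / 8 + 1" using z by (auto simp: gaps_def)
  have "l * norm z = norm (of_real l * z)" using l by (simp add: norm_mult)
  also have "\<dots> \<le> norm w + 1"
    using norm_triangle_ineq4[of w "w - of_real l * z"] w by simp
  finally have 1: "norm w \<ge> l * norm z - 1" by simp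
  moreover have "l * norm z \<ge> 32 * norm z" using l by (intro mult_right_mono) auto
  ultimately show 2: "norm w \<ge> 2 * norm z" using z1 by linarith
  have "norm w \<ge> 31" using 1 \<open>l * norm z \<ge> 32 * norm z\<close> z1 by linarith
  have "norm (w - of_real (l ^ k)) > l ^ k / 8 + 1" for k
  \<comment> \<open>The disc about \<open>l ^ 0 = 1\<close> is not the image of an earlier disc;
    \<open>w\<close> avoids it merely by being large.\<close>
  proof (cases k)
    case 0
    then show ?thesis using norm_triangle_ineq2[of w 1] \<open>norm w \<ge> 31\<close> by simp
  next
    case (Suc j)
    have "norm (of_real l * (z - of_real (l ^ j))) = l * norm (z - of_real (l ^ j))"
      using l by (simp add: norm_mult del: of_real_power)
    moreover have "l * norm (z - of_real (l ^ j)) \<ge> l * (l ^ j / 8 + 1)"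
      using zk[of j] l by (intro mult_left_mono) auto
    moreover have "norm (of_real l * (z - of_real (l ^ j))) \<le> norm (w - of_real (l ^ k)) + norm (w - of_real l * z)"
      using norm_triangle_ineq4[of "w - of_real (l ^ k)" "w - of_real l * z"] by (simp add: Suc algebra_simps)
    ultimately have "norm (w - of_real (l ^ k)) \<ge> l * (l ^ j / 8 + 1) - 1" using w by linarith
    moreover have "l * (l ^ j / 8 + 1) - 1 > l ^ k / 8 + 1" using l by (simp add: Suc algebra_simps)
    ultimately show ?thesis by linarith
  qed
  then show "w \<in> gaps l" using \<open>norm w \<ge> 31\<close> by (auto simp: gaps_def)
qed

text \<open>The half-plane meets every annulus used below and so places all of them in one Fatou
  component; it also contains the base point and its image.\<close>

lemma half_plane_subset_gaps:
  assumes "l > 0"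
  shows "{z. Re z < - 2} \<subseteq> gaps l"
proof
  fix z assume z: "z \<in> {z. Re z < - 2}"
  have "norm (z - of_real (l ^ k)) > l ^ k / 8 + 1" for k
  proof -
    have "norm (z - of_real (l ^ k)) \<ge> l ^ k - Re z"
      using abs_Re_le_cmod[of "z - of_real (l ^ k)"] by (simp del: of_real_power)
    moreover have "l ^ k > 0" using assms by simp
    ultimately show ?thesis using z by (simp del: of_real_power)
  qed
  moreover have "norm z > 1" using z abs_Re_le_cmod[of z] by simp
  ultimately show "z \<in> gaps l" by (simp add: gaps_def)
qed

text \<open>Discs of index at most \<open>j\<close> end well before \<open>4 * l ^ j\<close>; those
  of larger index start beyond \<open>l ^ Suc j / 2\<close>.\<close>

lemma annulus_subset_gaps:
  assumes l: "l \<ge> 32"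
  shows "{z. 4 * l ^ j < norm z \<and> norm z < l ^ Suc j / 2} \<subseteq> gaps l"
proof
  fix z :: complex assume z: "z \<in> {z. 4 * l ^ j < norm z \<and> norm z < l ^ Suc j / 2}"
  have lj: "l ^ j \<ge> 1" using l by (simp add: one_le_power)
  have "norm (z - of_real (l ^ k)) > l ^ k / 8 + 1" for k
  proof -
    have n: "norm (of_real (l ^ k) :: complex) = l ^ k" using l by (simp del: of_real_power)
    show ?thesis
    proof (cases "k \<le> j")
      case True
      then have "l ^ k \<le> l ^ j" using l by (intro power_increasing) auto
      then show ?thesis using norm_triangle_ineq2[of z "of_real (l ^ k)"] n z lj by simp
    next
      case False
      then have "l ^ Suc j \<le> l ^ k" using l by (intro power_increasing) auto
      moreover have "l ^ Suc j \<ge> 32 * l ^ j" using l by (simp add: mult_right_mono)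
      moreover have "norm (z - of_real (l ^ k)) \<ge> l ^ k - norm z"
        using norm_triangle_ineq2[of "of_real (l ^ k)" z] n by (simp add: norm_minus_commute)
      moreover have "norm z < l ^ Suc j / 2" using z by simp
      ultimately show ?thesis using lj by linarith
    qed
  qed
  moreover have "norm z > 1" using z lj by simp
  ultimately show "z \<in> gaps l" by (simp add: gaps_def)
qed

lemma filterlim_realpow_at_top:
  fixes b :: real
  assumes "b > 1"
  shows "filterlim (\<lambda>n. b ^ n) at_top sequentially"
proof -
  have "filterlim (\<lambda>n. norm (b ^ n)) at_top sequentially"
    using assms by (intro filterlim_at_infinity_imp_norm_at_top filterlim_realpow_sequentially_gt1) simp
  moreover have "norm (b ^ n) = b ^ n" for n using assms by simp
  ultimately show ?thesis by simp
qed

theorem theorem1p4: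
  fixes \<rho> :: real
  assumes "\<rho> > 0"
  shows "\<exists>(f :: complex \<Rightarrow> complex) (U :: complex set).
    transcendental_meromorphic f \<and>
    invariant_Baker_domain f U \<and>
    (\<forall>a\<in>sing_inverse f. super_attracting_period_2 f a) \<and>
    (\<exists>R :: nat \<Rightarrow> real.
       (\<forall>j. R j > 0) \<and> filterlim R at_top sequentially \<and>
       (\<forall>j. {z. R j < norm z \<and> norm z < \<rho> * R j} \<subseteq> U))"
proof -
  \<comment> \<open>With \<open>l \<ge> 8 * \<rho>\<close> the radius
    \<open>\<rho> * (4 * l ^ j)\<close> is at most \<open>l ^ Suc j / 2\<close>.\<close>
  define l where "l = 32 + 8 * \<rho>"
  have l: "l \<ge> 32" "l \<ge> 8 * \<rho>" using assms by (auto simp: l_def)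
  obtain f P where infP: "infinite P" and Pisl: "P \<subseteq> (\<Union>k. island l k)"
    and pole: "\<And>p. p \<in> P \<Longrightarrow> is_pole f p" and f0: "\<And>p. p \<in> P \<Longrightarrow> f p = 0"
    and an: "\<And>z. z \<notin> P \<Longrightarrow> f analytic_on {z}"
    and close: "\<And>z. z \<notin> (\<Union>k. island l k) \<Longrightarrow> norm (f z - of_real l * z) \<le> 1"
    and cyc: "\<And>c. c \<notin> P \<Longrightarrow> deriv f c = 0 \<Longrightarrow> f c \<notin> P \<and> f (f c) \<notin> P \<and> f (f (f c)) = f c \<and>
       deriv f (f (f c)) = 0 \<and> f (f c) \<noteq> f c"
    by (rule limit_function[OF l(1)]) blast

  \<comment> \<open>Meromorphy and transcendence\<close>
  have pole_iff: "is_pole f z \<longleftrightarrow> z \<in> P" for z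
    using pole an analytic_at_imp_no_pole by blast
  have mero: "f nicely_meromorphic_on UNIV"
    unfolding nicely_meromorphic_on_def
  proof (intro conjI ballI)
    show "f meromorphic_on UNIV"
    proof (subst meromorphic_on_meromorphic_at, intro ballI)
      fix z
      show "f meromorphic_on {z}"
      proof (cases "z \<in> P")
        case False
        then show ?thesis using an analytic_on_imp_meromorphic_on by blast
      next
        case True
        \<comment> \<open>\<open>f\<close> is large near a pole but vanishes on \<open>P\<close>, so the poles are isolated.\<close>
        have "\<forall>\<^sub>F w in at z. f w \<noteq> 0" using pole[OF True] by (rule non_zero_neighbour_pole)
        then obtain r where r: "r > 0" "\<And>w. w \<noteq> z \<Longrightarrow> dist w z < r \<Longrightarrow> f w \<noteq> 0"
          unfolding eventually_at by auto
        have "f analytic_on ball z r - {z}"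
        proof (subst analytic_on_analytic_at, intro ballI)
          fix w assume "w \<in> ball z r - {z}"
          then have "w \<notin> P" using f0 r(2)[of w] by (auto simp: dist_commute)
          then show "f analytic_on {w}" by (rule an)
        qed
        then have "isolated_singularity_at f z" using r(1) unfolding isolated_singularity_at_def by blast
        then show ?thesis using pole[OF True] by (simp add: meromorphic_at_iff is_pole_imp_not_essential)
      qed
    qed
    show "is_pole f z \<and> f z = 0 \<or> f \<midarrow>z\<rightarrow> f z" for z
      using pole f0 analytic_at_imp_isCont[OF an] by (cases "z \<in> P") (auto simp: isCont_def)
  qed
  have Pset: "{z. is_pole f z} = P" using pole_iff by blast
  have "\<not> rational_map f" using rational_map_finite_poles[of f] infP by (auto simp: Pset)
  then have trans: "transcendental_meromorphic f" using mero by (simp add: transcendental_meromorphic_def)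

  \<comment> \<open>The Baker domain\<close>
  define W where "W = gaps l"
  have WP: "w \<notin> P" if "w \<in> W" for w using that gaps_island_disjoint[of l] Pisl unfolding W_def by blast
  have fW: "f w \<in> W" "norm (f w) \<ge> 2 * norm w" if "w \<in> W" for w
    using gaps_image[OF l(1), of w "f w"] close[of w] gaps_island_disjoint[of l] that unfolding W_def by blast+
  have W1: "norm w > 1" if "w \<in> W" for w using that by (simp add: W_def gaps_def)
  have growth: "(f ^^ n) w \<in> W \<and> 2 ^ n \<le> norm ((f ^^ n) w)" if "w \<in> W" for n w
  proof (induction n)
    case 0
    then show ?case using that W1[OF that] by simp
  next
    case (Suc n)
    then have "(f ^^ n) w \<in> W" "2 ^ n \<le> norm ((f ^^ n) w)" by auto
    then show ?case using fW[of "(f ^^ n) w"] by simp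
  qed
  have pow2: "filterlim (\<lambda>n. 2 ^ n :: real) at_top sequentially"
    by (rule filterlim_realpow_at_top) simp
  have W_Fatou: "W \<subseteq> Fatou_set f"
    using open_gaps[OF l(1)] fW WP growth pow2
    by (intro uniformly_escaping_subset_Fatou_set[where a = "\<lambda>n. 2 ^ n"]) (auto simp: W_def pole_iff)

  define L where "L = {z. Re z < - 2}"
  have L: "connected L" "open L" "L \<subseteq> W" "- 3 \<in> L"
    using half_plane_subset_gaps[of l] l
    by (auto simp: L_def W_def convex_connected convex_halfspace_Re_lt open_halfspace_Re_lt)
  define U where "U = connected_component_set (Fatou_set f) (- 3)"
  have LU: "L \<subseteq> U" unfolding U_def using L W_Fatou by (intro connected_component_maximal) auto
  have U_Fatou: "U \<subseteq> Fatou_set f" unfolding U_def by (rule connected_component_subset)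
  have compU: "Fatou_component f U"
    unfolding Fatou_component_def U_def using L W_Fatou by (intro componentsI) auto
  have nc: "\<not> f constant_on - {z. is_pole f z}"
  proof
    assume "f constant_on - {z. is_pole f z}"
    then obtain c where c: "\<And>z. z \<notin> P \<Longrightarrow> f z = c" unfolding constant_on_def Pset by auto
    \<comment> \<open>A constant value \<open>c\<close> would lie in \<open>W\<close> and be fixed,
      although \<open>f\<close> at least doubles the modulus there.\<close>
    have m3: "- 3 \<in> W" using L by blast
    then have "f (- 3) = c" "f (f (- 3)) = c" using c WP fW(1) by blast+
    then show False using fW(2)[OF fW(1)[OF m3]] W1[OF fW(1)[OF m3]] by simp
  qed
  have "f ` U \<subseteq> U"
  proof -
    have "f analytic_on U"
      using iterates_analytic_on_Fatou_set[OF mero, of 1] U_Fatou analytic_on_subset by simp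
    then have "connected (f ` U)"
      by (intro connected_continuous_image holomorphic_on_imp_continuous_on analytic_imp_holomorphic)
         (simp_all add: U_def)
    moreover have "f ` U \<subseteq> Fatou_set f" using Fatou_set_image[OF mero nc] U_Fatou by blast
    moreover have "f (- 3) \<in> f ` U" using LU L by blast
    ultimately have sub: "f ` U \<subseteq> connected_component_set (Fatou_set f) (f (- 3))"
      by (intro connected_component_maximal)
    have "norm (f (- 3) - of_real l * (- 3)) \<le> 1"
      using L gaps_island_disjoint[of l] unfolding W_def by (intro close) blast
    then have "\<bar>Re (f (- 3) + of_real l * 3)\<bar> \<le> 1"
      using abs_Re_le_cmod[of "f (- 3) + of_real l * 3"] by simp
    then have "f (- 3) \<in> L" using l by (simp add: L_def)
    then have "f (- 3) \<in> U" using LU by blast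
    then show ?thesis using sub connected_component_eq unfolding U_def by metis
  qed
  moreover have "filterlim (\<lambda>n. (f ^^ n) z) at_infinity sequentially" if "z \<in> U" for z
  proof (rule Fatou_component_escape[OF mero _ _ U_Fatou L(2) _ LU _ that])
    show "connected U" "open U" unfolding U_def by (simp_all add: open_connected_component Fatou_set_open)
    show "L \<noteq> {}" using L by blast
    fix w assume "w \<in> L"
    then have "2 ^ n \<le> norm ((f ^^ n) w)" for n using growth L by blast
    then have "filterlim (\<lambda>n. norm ((f ^^ n) w)) at_top sequentially"
      by (intro filterlim_at_top_mono[OF pow2]) simp
    then show "filterlim (\<lambda>n. (f ^^ n) w) at_infinity sequentially" by (rule filterlim_norm_at_top_imp_at_infinity)
  qed
  ultimately have baker: "invariant_Baker_domain f U" using compU by (simp add: invariant_Baker_domain_def)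

  \<comment> \<open>Singular values\<close>
  have "super_attracting_period_2 f a" if a: "a \<in> sing_inverse f" for a
  proof -
    have "\<not> finite_asymptotic_value f a"
    proof
      assume "finite_asymptotic_value f a"
      then obtain \<gamma> :: "real \<Rightarrow> complex" where \<gamma>: "continuous_on {0..} \<gamma>" "filterlim \<gamma> at_infinity at_top"
        "((\<lambda>t. f (\<gamma> t)) \<longlongrightarrow> a) at_top" unfolding finite_asymptotic_value_def by blast
      have "\<forall>\<^sub>F t in at_top. dist (f (\<gamma> t)) a < 1" using \<gamma>(3) by (rule tendstoD) simp
      then obtain t0 where t0: "\<And>t. t \<ge> t0 \<Longrightarrow> dist (f (\<gamma> t)) a < 1" by (auto simp: eventually_at_top_linorder)
      define t1 where "t1 = max t0 0"
      have norm\<gamma>: "filterlim (\<lambda>t. norm (\<gamma> t)) at_top at_top" using \<gamma>(2) by (rule filterlim_at_infinity_imp_norm_at_top)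
      \<comment> \<open>The circle of radius \<open>5 * l ^ j\<close> lies in a gap annulus,
        encloses \<open>\<gamma> t1\<close>, and \<open>|f|\<close> is at least
        \<open>10 * l ^ j > |a| + 1\<close> on it.\<close>
      obtain j where j: "norm (\<gamma> t1) + norm a + 1 < l ^ j" using real_arch_pow[of l] l by auto
      obtain t2 where t2: "t2 \<ge> t1" "norm (\<gamma> t2) \<ge> 5 * l ^ j"
        using norm\<gamma> unfolding filterlim_at_top eventually_at_top_linorder by (metis max.cobounded1 max.cobounded2)
      have lj: "l ^ j > 0" using l by simp
      have "\<exists>t\<ge>t1. t \<le> t2 \<and> norm (\<gamma> t) = 5 * l ^ j"
      proof (rule IVT')
        show "norm (\<gamma> t1) \<le> 5 * l ^ j" using j lj norm_ge_zero[of a] by linarith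
        show "continuous_on {t1..t2} (\<lambda>t. norm (\<gamma> t))"
          using \<gamma>(1) by (intro continuous_on_norm) (rule continuous_on_subset, auto simp: t1_def)
      qed (use t2 in auto)
      then obtain t where t: "t \<ge> t1" "norm (\<gamma> t) = 5 * l ^ j" by blast
      have "l ^ Suc j \<ge> 32 * l ^ j" using l by (simp add: mult_right_mono)
      then have "\<gamma> t \<in> W" unfolding W_def using t lj by (intro subsetD[OF annulus_subset_gaps[OF l(1), of j]]) simp
      then have "norm (f (\<gamma> t)) \<ge> 2 * (5 * l ^ j)" using fW(2) t by fastforce
      moreover have "dist (f (\<gamma> t)) a < 1" using t0 t by (simp add: t1_def)
      then have "norm (f (\<gamma> t)) < norm a + 1" using norm_triangle_ineq2[of "f (\<gamma> t)" a] by (simp add: dist_norm)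
      ultimately show False using j lj norm_ge_zero[of "\<gamma> t1"] by linarith
    qed
    then obtain c where c: "critical_point f c" "\<not> is_pole f c" "f c = a"
      using a by (auto simp: sing_inverse_def finite_critical_value_def)
    have "deriv f c = 0" by (rule critical_point_deriv_zero[OF mero c(1,2)])
    then have cy: "a \<notin> P" "f a \<notin> P" "f (f a) = a" "deriv f (f a) = 0" "f a \<noteq> a"
      using cyc[of c] c by (auto simp: pole_iff)
    have diff: "f field_differentiable at z" if "z \<notin> P" for z
      using an[OF that] analytic_on_imp_differentiable_at by blast
    have "deriv (f \<circ> f) a = deriv f (f a) * deriv f a"
      by (rule deriv_chain) (use cy diff in auto)
    then have "deriv (f ^^ 2) a = 0" using cy by (simp add: numeral_2_eq_2)
    then show ?thesis using cy by (simp add: super_attracting_period_2_def pole_iff numeral_2_eq_2)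
  qed

  \<comment> \<open>Annuli in the Baker domain\<close>
  moreover have "\<exists>R :: nat \<Rightarrow> real. (\<forall>j. R j > 0) \<and> filterlim R at_top sequentially \<and>
       (\<forall>j. {z. R j < norm z \<and> norm z < \<rho> * R j} \<subseteq> U)"
  proof (intro exI[of _ "\<lambda>j. 4 * l ^ j"] conjI allI)
    show "4 * l ^ j > 0" for j using l by simp
    have "filterlim (\<lambda>j. l ^ j) at_top sequentially"
      using l by (intro filterlim_realpow_at_top) simp
    then show "filterlim (\<lambda>j. 4 * l ^ j) at_top sequentially"
      by (intro filterlim_tendsto_pos_mult_at_top[OF tendsto_const]) auto
    fix j
    have lj: "l ^ j \<ge> 1" using l by (simp add: one_le_power)
    define A where "A = {z::complex. 4 * l ^ j < norm z \<and> norm z < l ^ Suc j / 2}"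
    have "{z::complex. 4 * l ^ j < norm z \<and> norm z < \<rho> * (4 * l ^ j)} \<subseteq> A"
    proof -
      have "l ^ Suc j \<ge> 8 * \<rho> * l ^ j" using l by (simp add: mult_right_mono)
      then show ?thesis by (auto simp: A_def)
    qed
    moreover have "A \<union> L \<subseteq> U" unfolding U_def
    proof (rule connected_component_maximal)
      \<comment> \<open>The factor 8 lies between the 4 of the inner radius and
        \<open>l / 2 \<ge> 16\<close> of the outer one.\<close>
      have "- of_real (8 * l ^ j) \<in> A \<inter> L"
      proof -
        have "l ^ Suc j \<ge> 32 * l ^ j" using l by (simp add: mult_right_mono)
        moreover have "norm (- of_real (8 * l ^ j) :: complex) = 8 * l ^ j"
          using l by (simp add: norm_mult norm_power)
        moreover have "Re (- of_real (8 * l ^ j)) = - (8 * l ^ j)" by (simp only: uminus_complex.sel Re_complex_of_real)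
        ultimately show ?thesis using lj unfolding A_def L_def Int_iff mem_Collect_eq
          by (intro conjI) linarith+
      qed
      moreover have "connected A" using connected_annulus(1)[of "4 * l ^ j" "0 :: complex" "l ^ Suc j / 2"] by (simp add: A_def)
      ultimately show "connected (A \<union> L)" using L(1) by (intro connected_Un) auto
      show "A \<union> L \<subseteq> Fatou_set f"
        using annulus_subset_gaps[OF l(1), of j] L(3) W_Fatou unfolding A_def W_def by blast
    qed (use L in blast)
    ultimately show "{z. 4 * l ^ j < norm z \<and> norm z < \<rho> * (4 * l ^ j)} \<subseteq> U" by blast
  qed
  ultimately show ?thesis using trans baker by blast
qed

end
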